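(* Let $\mathcal{B}=\{b_n\}_{n=1}^\infty$ and $\mathcal{D}=\{d_n\}_{n=1}^\infty$ be sequences of positive integers such that $1<d_n<b_n$ and $2\le b_n/d_n\in\mathbb{Z}$ for all $n\ge 1$. Then $$\Lambda_{\mathcal{B},\mathcal{D}}:=\bigcup_{L=1}^\infty\Big\{\sum_{n=1}^L c_n\rho_n:\ c_n\in\{0,1,\ldots,d_n-1\}\ \text{for}\ 1\le n\le L\Big\}$$ is a spectrum of the Riesz product measure $\mu_{\mathcal{B},\mathcal{D}}$.
   Context: Set $\rho_1:=1$ and $\rho_n:=\prod_{j=1}^{n-1}b_j$ for $n\ge 2$. The Fourier transform of a probability measure $\mu$ on $\mathbb{R}$ is $\hat\mu(\xi):=\int_{\mathbb{R}}e^{-2\pi i\xi x}\,d\mu(x)$. For $m\ge 1$ let $H_m(\xi):=\frac1m\sum_{j=0}^{m-1}e^{-2\pi i j\xi}$. The Riesz product measure $\mu_{\mathcal{B},\mathcal{D}}$ is the compactly supported probability measure on $\mathbb{R}$ defined by $$\widehat{\mu_{\mathcal{B},\mathcal{D}}}(\xi)=\prod_{n=1}^\infty H_{d_n}\Big(\frac{\xi}{d_n\rho_n}\Big).$$ A countable set $\Lambda\subset\mathbb{R}$ is a spectrum of a compactly supported probability measure $\mu$ if $\{e^{-2\pi i\lambda x}:\lambda\in\Lambda\}$ forms an orthonormal basis for $L^2(\mu)$. *)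

theory Defs
  imports "HOL-Probability.Probability"
begin

text \<open>Sequences are indexed from 1; the values of \<open>b\<close> and \<open>d\<close> at 0 are never used.\<close>

definition rho :: "(nat \<Rightarrow> nat) \<Rightarrow> nat \<Rightarrow> nat" where
  "rho b n = (\<Prod>j\<in>{1..<n}. b j)"

definition expo :: "real \<Rightarrow> real \<Rightarrow> complex" where
  "expo l x = exp (- 2 * of_real pi * \<i> * of_real l * of_real x)"

definition fourier_transform :: "real measure \<Rightarrow> real \<Rightarrow> complex" where
  "fourier_transform \<mu> \<xi> = (LINT x|\<mu>. expo \<xi> x)"

definition H :: "nat \<Rightarrow> real \<Rightarrow> complex" where
  "H m \<xi> = (1 / of_nat m) * (\<Sum>j<m. expo (of_nat j) \<xi>)"

definition compactly_supported_prob :: "real measure \<Rightarrow> bool" where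
  "compactly_supported_prob \<mu> \<longleftrightarrow>
     real_distribution \<mu> \<and> (\<exists>K. compact K \<and> (AE x in \<mu>. x \<in> K))"

text \<open>The factor \<open>n = 0\<close> of \<^const>\<open>has_prod\<close> is the factor with index 1 in the infinite product.
  The measure is determined by its Fourier transform, so \<open>THE\<close> selects it as soon as it exists.\<close>

definition riesz_product_measure :: "(nat \<Rightarrow> nat) \<Rightarrow> (nat \<Rightarrow> nat) \<Rightarrow> real measure" where
  "riesz_product_measure b d = (THE \<mu>. compactly_supported_prob \<mu> \<and>
     (\<forall>\<xi>. (\<lambda>n. H (d (Suc n)) (\<xi> / (real (d (Suc n)) * real (rho b (Suc n)))))
            has_prod fourier_transform \<mu> \<xi>))"

definition L2_space :: "'a measure \<Rightarrow> ('a \<Rightarrow> complex) set" where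
  "L2_space M = {f \<in> borel_measurable M. integrable M (\<lambda>x. (cmod (f x))\<^sup>2)}"

definition L2_inner :: "'a measure \<Rightarrow> ('a \<Rightarrow> complex) \<Rightarrow> ('a \<Rightarrow> complex) \<Rightarrow> complex" where
  "L2_inner M f g = (LINT x|M. f x * cnj (g x))"

definition L2_nrm :: "'a measure \<Rightarrow> ('a \<Rightarrow> complex) \<Rightarrow> real" where
  "L2_nrm M f = sqrt (LINT x|M. (cmod (f x))\<^sup>2)"

text \<open>Elements of \<open>L\<^sup>2(M)\<close> are represented by functions. The family \<open>(\<phi> i)\<^bsub>i \<in> I\<^esub>\<close> is an
  orthonormal basis if it is orthonormal and its linear span is dense.
  Orthonormality is that of a family: distinct indices give orthogonal elements.\<close>

definition L2_orthonormal_basis ::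
  "'a measure \<Rightarrow> ('i \<Rightarrow> 'a \<Rightarrow> complex) \<Rightarrow> 'i set \<Rightarrow> bool" where
  "L2_orthonormal_basis M \<phi> I \<longleftrightarrow>
     (\<forall>i\<in>I. \<phi> i \<in> L2_space M) \<and>
     (\<forall>i\<in>I. \<forall>j\<in>I. L2_inner M (\<phi> i) (\<phi> j) = (if i = j then 1 else 0)) \<and>
     (\<forall>f\<in>L2_space M. \<forall>\<epsilon>>0. \<exists>F c. finite F \<and> F \<subseteq> I \<and>
        L2_nrm M (\<lambda>x. f x - (\<Sum>i\<in>F. c i * \<phi> i x)) < \<epsilon>)"

definition is_spectrum :: "real measure \<Rightarrow> real set \<Rightarrow> bool" where
  "is_spectrum \<mu> \<Lambda> \<longleftrightarrow>
     compactly_supported_prob \<mu> \<and> countable \<Lambda> \<and> L2_orthonormal_basis \<mu> expo \<Lambda>"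

definition Lambda_set :: "(nat \<Rightarrow> nat) \<Rightarrow> (nat \<Rightarrow> nat) \<Rightarrow> real set" where
  "Lambda_set b d =
     (\<Union>L\<in>{1..}. {real (\<Sum>n=1..L. c n * rho b n) | c. \<forall>n\<in>{1..L}. c n \<in> {0..d n - 1}})"

end

theory Submission imports Defs begin

text \<open>
  Write \<open>e\<^sub>t(x) = exp (-2\<pi>itx)\<close>, let \<open>\<mu>\<close> be the Riesz product measure, \<open>m\<close> its Fourier transform,
  \<open>P\<^sub>n\<close> the product of the first \<open>n\<close> factors of \<open>m\<close>, and \<open>\<Lambda>\<^sub>n\<close> the finite set of digit sums of length
  \<open>n\<close>. The measure \<open>\<mu>\<close> is the law of the random series whose \<open>n\<close>-th term is a uniform digit in
  \<open>{0, \<dots>, d\<^sub>n - 1}\<close> divided by \<open>d\<^sub>n\<rho>\<^sub>n\<close>, with independent digits; it is unique by Levy's theorem.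

  At a finite level everything is finite Fourier analysis. As \<open>d\<^sub>n\<close> divides \<open>b\<^sub>n\<close>, the product \<open>P\<^sub>n\<close> has
  period \<open>\<rho>\<^sub>n\<^sub>+\<^sub>1\<close>, so a new leading digit affects only the newest factor, and Parseval's identity on
  the integers modulo \<open>d\<^sub>n\<close> (\<open>H_parseval\<close>) gives by induction
  \<open>\<Sum>\<^bsub>l \<in> \<Lambda>\<^sub>n\<^esub> |P\<^sub>n(t - l)|\<^sup>2 = 1\<close> for all real \<open>t\<close> (\<open>riesz_prod_parseval\<close>). Choosing \<open>t\<close> in \<open>\<Lambda>\<^sub>n\<close>, where
  one term is already \<open>1\<close>, shows that the other terms vanish, and hence that the \<open>e\<^sub>l\<close> are orthonormal.

  Completeness needs this identity for \<open>m\<close> itself (\<open>riesz_fourier_parseval\<close>), where mass might escape to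
  infinity. It does not, because \<open>2 \<le> b\<^sub>n / d\<^sub>n\<close> places \<open>\<Lambda>\<^sub>n\<close> in the first half of
  \<open>[0, \<rho>\<^sub>n\<^sub>+\<^sub>1)\<close> (\<open>digit_sums_less\<close>). At \<open>t - l\<close> with \<open>l\<close> in \<open>\<Lambda>\<^sub>n\<close>, for fixed \<open>t\<close> and large \<open>n\<close>, the
  remaining factors of \<open>m\<close> have a product whose modulus is at least a fixed positive constant (\<open>riesz_fourier_bounded_below\<close>): the first of them stays
  away from the zero of the sinc function at \<open>1\<close>, and the others tend to \<open>1\<close> geometrically. Thus
  \<open>|P\<^sub>n(t - l)|\<^sup>2\<close> is dominated by a multiple of \<open>|m(t - l)|\<^sup>2\<close>, which is summable, and the limit may be
  taken under the sum.

  Since \<open>m(t - l)\<close> is the inner product of \<open>e\<^sub>t\<close> and \<open>e\<^sub>l\<close>, the identity for \<open>m\<close> says that every \<open>e\<^sub>t\<close>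
  lies in the closed span of the \<open>e\<^sub>l\<close>. It remains that all exponentials together are total in
  \<open>L\<^sup>2\<close> of a compactly supported measure (\<open>L2_space_subset_closed_span\<close>), by the Stone-Weierstrass theorem.
\<close>

section \<open>Exponentials and the Dirichlet kernel\<close>

lemma expo_cis: "expo l x = cis (- (2 * pi * l * x))"
  by (simp add: expo_def cis_conv_exp algebra_simps)

lemma expo_add: "expo (l + l') x = expo l x * expo l' x"
  by (simp add: expo_cis cis_mult algebra_simps)

lemma expo_add_right: "expo l (x + y) = expo l x * expo l y"
  by (simp add: expo_cis cis_mult algebra_simps)

lemma expo_0 [simp]: "expo 0 x = 1" "expo l 0 = 1"
  by (simp_all add: expo_cis)

lemma norm_expo [simp]: "cmod (expo l x) = 1"
  by (simp add: expo_cis)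

lemma cnj_expo: "cnj (expo l x) = expo (- l) x"
  by (simp add: expo_cis cis_cnj)

lemma expo_diff: "expo (l - l') x = expo l x * cnj (expo l' x)"
  by (simp add: cnj_expo flip: expo_add)

lemma expo_eq_1: "l * x \<in> \<int> \<Longrightarrow> expo l x = 1"
  using cis_multiple_2pi[of "-(l * x)"] by (simp add: expo_cis mult.assoc)

lemma expo_power: "expo (of_nat j) x = expo 1 x ^ j"
  by (induction j) (simp_all add: expo_add)

lemma continuous_expo [continuous_intros]: "continuous_on S (expo l)"
  unfolding expo_def by (intro continuous_intros)

lemma borel_measurable_expo [measurable]: "expo l \<in> borel_measurable borel"
  by (intro borel_measurable_continuous_onI continuous_intros)

lemma norm_one_minus_expo: "cmod (1 - expo 1 x) = 2 * \<bar>sin (pi * x)\<bar>"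
proof -
  have "(cmod (1 - expo 1 x))\<^sup>2 = (1 - cos (2 * pi * x))\<^sup>2 + (sin (2 * pi * x))\<^sup>2"
    by (simp add: expo_cis cmod_power2)
  also have "\<dots> = 2 - 2 * cos (2 * (pi * x))"
    using sin_cos_squared_add[of "2 * pi * x"] by (simp add: power2_eq_square algebra_simps)
  also have "\<dots> = (2 * \<bar>sin (pi * x)\<bar>)\<^sup>2"
    by (simp add: cos_double_sin power_mult_distrib)
  finally show ?thesis
    by (simp only: power2_eq_iff_nonneg norm_ge_zero abs_ge_zero mult_nonneg_nonneg zero_le_numeral)
qed

lemma norm_one_minus_expo_le: "cmod (1 - expo l x) \<le> 2 * pi * \<bar>l * x\<bar>"
proof -
  have "cmod (1 - expo l x) = 2 * \<bar>sin (pi * (l * x))\<bar>"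
    using norm_one_minus_expo[of "l * x"] by (simp add: expo_cis mult.assoc)
  also have "\<dots> \<le> 2 * (pi * \<bar>l * x\<bar>)"
    using abs_sin_x_le_abs_x[of "pi * (l * x)"] by (simp add: abs_mult)
  finally show ?thesis by simp
qed

lemma norm_H_le_1: "cmod (H m t) \<le> 1"
proof (cases "m = 0")
  case False
  have "cmod (\<Sum>j<m. expo (of_nat j) t) \<le> (\<Sum>j<m. 1)"
    by (rule order_trans[OF norm_sum]) simp
  then show ?thesis
    using False by (simp add: H_def norm_divide)
qed (simp add: H_def)

lemma H_0: "m > 0 \<Longrightarrow> H m 0 = 1"
  by (simp add: H_def)

lemma H_add_Ints: "k \<in> \<int> \<Longrightarrow> H m (t + k) = H m t"
  by (simp add: H_def expo_add_right expo_eq_1)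

text \<open>The points \<open>c / m\<close> are the characters of the integers modulo \<open>m\<close>: after the square is expanded
  into a double sum over frequencies \<open>j, k < m\<close>, the sum over \<open>c\<close> of an \<open>m\<close>-th root of unity removes all terms off
  the diagonal.\<close>

lemma H_parseval:
  assumes "m > 0"
  shows "(\<Sum>c<m. (cmod (H m (t - real c / real m)))\<^sup>2) = 1"
proof -
  define z where "z j c = expo (real j) (- real c / real m)" for j c
  have roots: "(\<Sum>c<m. z j c * cnj (z k c)) = (if j = k then of_nat m else 0)"
    if jk: "j < m" "k < m" for j k
  proof (cases "j = k")
    case False
    define w where "w = expo (real j - real k) (- 1 / real m)"
    have eq: "z j c * cnj (z k c) = w ^ c" for c
    proof -
      have "w ^ c = expo (real c) ((real j - real k) * (- 1 / real m))"
        unfolding w_def expo_power by (simp add: expo_cis)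
      moreover have "z j c * cnj (z k c) = expo (real j - real k) (- real c / real m)"
        by (simp add: z_def expo_diff)
      ultimately show ?thesis
        by (simp add: expo_cis mult_ac)
    qed
    have "w ^ m = 1"
      using \<open>m > 0\<close> unfolding w_def
      by (subst eq[unfolded w_def, symmetric]) (simp add: z_def expo_eq_1)
    moreover have "w \<noteq> 1"
    proof
      assume "w = 1"
      then obtain i :: int where "2 * pi * ((real j - real k) / real m) = of_int (2 * i) * pi"
        unfolding w_def expo_def exp_eq_1 by auto
      then have "2 * pi * ((real j - real k) / real m) = 2 * pi * of_int i"
        by simp
      then have "(real j - real k) / real m = of_int i"
        by (metis mult_left_cancel pi_neq_zero mult_eq_0_iff zero_neq_numeral)
      then have "(real j - real k) = of_int i * real m"
        using \<open>m > 0\<close> by (simp add: field_simps)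
      then have "int j - int k = i * int m"
        by (metis of_int_diff of_int_eq_iff of_int_mult of_int_of_nat_eq)
      moreover from this have "i \<noteq> 0" using False by auto
      ultimately have "int m dvd (int j - int k)" "int j - int k \<noteq> 0"
        using False \<open>m > 0\<close> by auto
      \<comment> \<open>Distinct indices below \<open>m\<close> are not congruent modulo \<open>m\<close>.\<close>
      then have "int m \<le> \<bar>int j - int k\<bar>"
        by (metis abs_of_nat dvd_imp_le_int)
      then show False using jk by auto
    qed
    ultimately show ?thesis
      using False by (simp add: eq sum_gp_strict)
  qed (simp add: z_def flip: expo_diff)
  define a where "a j = expo (real j) t" for j
  have "complex_of_real ((cmod (H m (t - real c / real m)))\<^sup>2) =
      (1 / of_nat m ^ 2) * (\<Sum>j<m. \<Sum>k<m. a j * cnj (a k) * (z j c * cnj (z k c)))" for c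
  proof -
    have "H m (t - real c / real m) = (1 / of_nat m) * (\<Sum>j<m. a j * z j c)"
      unfolding H_def a_def z_def by (simp flip: expo_add_right)
    then show ?thesis
      unfolding complex_norm_square
      by (simp add: sum_product power2_eq_square mult_ac)
  qed
  then have "complex_of_real (\<Sum>c<m. (cmod (H m (t - real c / real m)))\<^sup>2) =
      (1 / of_nat m ^ 2) * (\<Sum>c<m. \<Sum>j<m. \<Sum>k<m. a j * cnj (a k) * (z j c * cnj (z k c)))"
    by (simp add: sum_distrib_left)
  also have "(\<Sum>c<m. \<Sum>j<m. \<Sum>k<m. a j * cnj (a k) * (z j c * cnj (z k c))) =
      (\<Sum>j<m. \<Sum>k<m. a j * cnj (a k) * (\<Sum>c<m. z j c * cnj (z k c)))"
    unfolding sum_distrib_left by (subst sum.swap) (rule sum.cong[OF refl], rule sum.swap)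
  also have "\<dots> = (\<Sum>j<m. \<Sum>k<m. if j = k then of_nat m else 0)"
    by (intro sum.cong refl) (auto simp: roots a_def simp flip: expo_diff)
  also have "\<dots> = of_nat m ^ 2"
    by (simp add: power2_eq_square)
  finally show ?thesis
    using \<open>m > 0\<close> by (simp add: of_real_eq_1_iff del: of_real_sum)
qed

lemma norm_H_minus_1_le:
  assumes "m > 0"
  shows "cmod (H m (x / real m) - 1) \<le> pi * \<bar>x\<bar>"
proof -
  have "H m (x / real m) - 1 = - (1 / of_nat m) * (\<Sum>j<m. 1 - expo (real j) (x / real m))"
    using assms by (simp add: H_def sum_subtractf field_simps)
  then have "cmod (H m (x / real m) - 1) = (1 / real m) * cmod (\<Sum>j<m. 1 - expo (real j) (x / real m))"
    by (simp add: norm_mult norm_divide)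
  also have "\<dots> \<le> (1 / real m) * (\<Sum>j<m. 2 * pi * \<bar>real j * (x / real m)\<bar>)"
    by (intro mult_left_mono sum_norm_le norm_one_minus_expo_le) auto
  also have "(\<Sum>j<m. 2 * pi * \<bar>real j * (x / real m)\<bar>) = 2 * (pi * \<bar>x\<bar> / real m) * (\<Sum>j<m. real j)"
    by (simp add: sum_distrib_left sum_divide_distrib abs_mult mult_ac)
  also have "(\<Sum>j<m. real j) = real m * (real m - 1) / 2"
    by (induction m) (simp_all add: field_simps)
  also have "(1 / real m) * (2 * (pi * \<bar>x\<bar> / real m) * (real m * (real m - 1) / 2)) =
      pi * \<bar>x\<bar> * ((real m - 1) / real m)"
    using assms by (simp add: field_simps)
  also have "\<dots> \<le> pi * \<bar>x\<bar>"
    using assms by (intro mult_right_le_one_le) (auto simp: field_simps)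
  finally show ?thesis .
qed

text \<open>The geometric sum gives \<open>(1 - e(y)) m H\<^sub>m(y) = 1 - e(m y)\<close> with \<open>e(y) = exp (-2\<pi>iy)\<close>; take
  \<open>y = x / m\<close> and use \<open>|1 - e(y)| \<le> 2\<pi>|y|\<close>. The bound is uniform in \<open>m\<close>.\<close>

lemma norm_H_ge_sinc: "m > 0 \<Longrightarrow> x \<noteq> 0 \<Longrightarrow> \<bar>sin (pi * x)\<bar> / (pi * \<bar>x\<bar>) \<le> cmod (H m (x / real m))"
proof -
  assume m: "m > 0" and x: "x \<noteq> 0"
  define y where "y = x / real m"
  have "(1 - expo 1 y) * (of_nat m * H m y) = 1 - expo 1 y ^ m"
    using m by (simp add: H_def expo_power one_diff_power_eq)
  also have "expo 1 y ^ m = expo 1 x"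
    using m by (subst expo_power[symmetric]) (simp add: y_def expo_cis mult.assoc)
  finally have "cmod (1 - expo 1 y) * (real m * cmod (H m y)) = cmod (1 - expo 1 x)"
    by (metis norm_mult norm_of_nat)
  then have "2 * \<bar>sin (pi * x)\<bar> = cmod (1 - expo 1 y) * (real m * cmod (H m y))"
    by (simp add: norm_one_minus_expo)
  also have "\<dots> \<le> (2 * pi * \<bar>y\<bar>) * (real m * cmod (H m y))"
    using norm_one_minus_expo_le[of 1 y] by (intro mult_right_mono) auto
  also have "\<dots> = 2 * pi * \<bar>x\<bar> * cmod (H m y)"
    using m by (simp add: y_def)
  finally show ?thesis
    using x by (simp add: y_def field_simps)
qed

text \<open>Near \<open>0\<close> the kernel is close to \<open>1\<close>, and elsewhere the sinc bound applies. Every threshold below the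
  first zero \<open>1\<close> of the sinc function would have a constant; it must exceed \<open>1/2\<close> to leave room for a
  shift of the digit sums, which fill up to one half of a period.\<close>

lemma H_bounded_below:
  "\<exists>c>0. \<forall>m>0. \<forall>x. \<bar>x\<bar> \<le> 3 / 4 \<longrightarrow> c \<le> cmod (H m (x / real m))"
proof -
  have pi4: "pi < 4" using pi_less_4 .
  define c where "c = min (1 - pi / 4) ((sqrt 2 / 2) / (pi * (3 / 4)))"
  have "c \<le> cmod (H m (x / real m))" if m: "m > 0" and x: "\<bar>x\<bar> \<le> 3 / 4" for m x
  proof (cases "\<bar>x\<bar> \<le> 1 / 4")
    case True
    have "1 - cmod (H m (x / real m)) \<le> cmod (H m (x / real m) - 1)"
      by (metis norm_minus_commute norm_one norm_triangle_ineq2)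
    also have "\<dots> \<le> pi * (1 / 4)"
      using norm_H_minus_1_le[OF m, of x] mult_left_mono[OF True, of pi] pi_ge_zero by linarith
    finally show ?thesis by (simp add: c_def)
  next
    case False
    have sin_ge: "sqrt 2 / 2 \<le> sin (pi * \<bar>x\<bar>)"
    proof (cases "\<bar>x\<bar> \<le> 1 / 2")
      case True
      have "sin (pi / 4) \<le> sin (pi * \<bar>x\<bar>)"
        using False True by (intro sin_monotone_2pi_le) (auto simp: field_simps)
      then show ?thesis by (simp add: sin_45)
    next
      case False
      have "sin (pi / 4) \<le> sin (pi - pi * \<bar>x\<bar>)"
        using False x by (intro sin_monotone_2pi_le) (auto simp: field_simps)
      then show ?thesis by (simp add: sin_45)
    qed
    have "c \<le> (sqrt 2 / 2) / (pi * (3 / 4))" by (simp add: c_def)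
    also have "\<dots> \<le> \<bar>sin (pi * x)\<bar> / (pi * \<bar>x\<bar>)"
    proof (rule frac_le)
      have "\<bar>sin (pi * x)\<bar> = \<bar>sin (pi * \<bar>x\<bar>)\<bar>" by (simp add: abs_if)
      then show "sqrt 2 / 2 \<le> \<bar>sin (pi * x)\<bar>" using sin_ge by linarith
    qed (use False x in auto)
    also have "\<dots> \<le> cmod (H m (x / real m))"
      using False by (intro norm_H_ge_sinc m) auto
    finally show ?thesis .
  qed
  moreover have "c > 0" using pi4 by (simp add: c_def)
  ultimately show ?thesis by blast
qed

section \<open>Closed linear spans in \<open>L\<^sup>2\<close>\<close>

text \<open>The density condition in an orthonormal basis is stated with coefficients on a finite subset of the
  index set. Treating the combinations as a set of functions, and using squared norms throughout,
  reduces it to closure properties of one set.\<close>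

definition combinations :: "('i \<Rightarrow> 'a \<Rightarrow> complex) \<Rightarrow> 'i set \<Rightarrow> ('a \<Rightarrow> complex) set" where
  "combinations \<phi> I = {\<lambda>x. \<Sum>i\<in>F. c i * \<phi> i x | F c. finite F \<and> F \<subseteq> I}"

definition sq_norm :: "'a measure \<Rightarrow> ('a \<Rightarrow> complex) \<Rightarrow> real" where
  "sq_norm M f = (LINT x|M. (cmod (f x))\<^sup>2)"

definition closed_span :: "'a measure \<Rightarrow> ('i \<Rightarrow> 'a \<Rightarrow> complex) \<Rightarrow> 'i set \<Rightarrow> ('a \<Rightarrow> complex) set" where
  "closed_span M \<phi> I =
     {f \<in> L2_space M. \<forall>\<epsilon>>0. \<exists>h\<in>combinations \<phi> I. sq_norm M (\<lambda>x. f x - h x) < \<epsilon>}"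

lemma L2_spaceD [measurable_dest]: "f \<in> L2_space M \<Longrightarrow> f \<in> borel_measurable M"
  by (simp add: L2_space_def)

lemma L2_space_integrable: "f \<in> L2_space M \<Longrightarrow> integrable M (\<lambda>x. (cmod (f x))\<^sup>2)"
  by (simp add: L2_space_def)

text \<open>This inequality serves in place of the triangle inequality in \<open>L\<^sup>2\<close>; the factor \<open>2\<close> is
  harmless in approximation arguments.\<close>

lemma norm_add_square_le: "(cmod (a + b))\<^sup>2 \<le> 2 * (cmod a)\<^sup>2 + 2 * (cmod b)\<^sup>2"
proof -
  have "(cmod (a + b))\<^sup>2 \<le> (cmod a + cmod b)\<^sup>2"
    by (intro power_mono norm_triangle_ineq) simp
  also have "\<dots> \<le> 2 * (cmod a)\<^sup>2 + 2 * (cmod b)\<^sup>2"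
    using sum_squares_bound[of "cmod a" "cmod b"] by (simp add: power2_eq_square algebra_simps)
  finally show ?thesis .
qed

lemma L2_space_add:
  assumes "f \<in> L2_space M" "g \<in> L2_space M"
  shows "(\<lambda>x. f x + g x) \<in> L2_space M"
    and "sq_norm M (\<lambda>x. f x + g x) \<le> 2 * sq_norm M f + 2 * sq_norm M g"
proof -
  note [measurable] = L2_spaceD[OF assms(1)] L2_spaceD[OF assms(2)]
  have int: "integrable M (\<lambda>x. 2 * (cmod (f x))\<^sup>2 + 2 * (cmod (g x))\<^sup>2)"
    using assms by (auto simp: L2_space_def)
  have int2: "integrable M (\<lambda>x. (cmod (f x + g x))\<^sup>2)"
    by (rule Bochner_Integration.integrable_bound[OF int]) (auto intro!: AE_I2 norm_add_square_le)
  then show "(\<lambda>x. f x + g x) \<in> L2_space M"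
    by (simp add: L2_space_def)
  have "sq_norm M (\<lambda>x. f x + g x) \<le> (LINT x|M. 2 * (cmod (f x))\<^sup>2 + 2 * (cmod (g x))\<^sup>2)"
    unfolding sq_norm_def by (intro integral_mono int int2 norm_add_square_le)
  also have "\<dots> = 2 * sq_norm M f + 2 * sq_norm M g"
    using assms by (simp add: sq_norm_def L2_space_def)
  finally show "sq_norm M (\<lambda>x. f x + g x) \<le> 2 * sq_norm M f + 2 * sq_norm M g" .
qed

lemma L2_space_bounded_mult:
  assumes f: "f \<in> L2_space M" and [measurable]: "g \<in> borel_measurable M"
    and bound: "AE x in M. cmod (g x) \<le> B"
  shows "(\<lambda>x. g x * f x) \<in> L2_space M"
    and "sq_norm M (\<lambda>x. g x * f x) \<le> B\<^sup>2 * sq_norm M f"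
proof -
  note [measurable] = L2_spaceD[OF f]
  have le: "AE x in M. (cmod (g x * f x))\<^sup>2 \<le> B\<^sup>2 * (cmod (f x))\<^sup>2"
    using bound
  proof eventually_elim
    case (elim x)
    then have "(cmod (g x))\<^sup>2 * (cmod (f x))\<^sup>2 \<le> B\<^sup>2 * (cmod (f x))\<^sup>2"
      by (intro mult_right_mono power_mono) auto
    then show ?case by (simp add: norm_mult power_mult_distrib)
  qed
  have int: "integrable M (\<lambda>x. B\<^sup>2 * (cmod (f x))\<^sup>2)"
    using f by (auto simp: L2_space_def)
  have int2: "integrable M (\<lambda>x. (cmod (g x * f x))\<^sup>2)"
    by (rule Bochner_Integration.integrable_bound[OF int]) (use le in \<open>auto elim: eventually_mono\<close>)
  then show "(\<lambda>x. g x * f x) \<in> L2_space M"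
    by (simp add: L2_space_def)
  have "sq_norm M (\<lambda>x. g x * f x) \<le> (LINT x|M. B\<^sup>2 * (cmod (f x))\<^sup>2)"
    unfolding sq_norm_def by (intro integral_mono_AE int int2 le)
  then show "sq_norm M (\<lambda>x. g x * f x) \<le> B\<^sup>2 * sq_norm M f"
    by (simp add: sq_norm_def)
qed

lemma L2_space_scale: "f \<in> L2_space M \<Longrightarrow> (\<lambda>x. a * f x) \<in> L2_space M"
  using L2_space_bounded_mult(1)[of f M "\<lambda>_. a" "cmod a"] by simp

lemma L2_space_diff: "f \<in> L2_space M \<Longrightarrow> g \<in> L2_space M \<Longrightarrow> (\<lambda>x. f x - g x) \<in> L2_space M"
  using L2_space_add(1)[of f M "\<lambda>x. - 1 * g x"] L2_space_scale[of g M "-1"] by simp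

lemma combinations_subset_L2_space:
  assumes "\<And>i. i \<in> I \<Longrightarrow> \<phi> i \<in> L2_space M" and "h \<in> combinations \<phi> I"
  shows "h \<in> L2_space M"
proof -
  obtain F c where F: "finite F" "F \<subseteq> I" and h: "h = (\<lambda>x. \<Sum>i\<in>F. c i * \<phi> i x)"
    using assms(2) by (auto simp: combinations_def)
  have "(\<lambda>x. \<Sum>i\<in>F. c i * \<phi> i x) \<in> L2_space M"
    using F
  proof (induction F rule: finite_induct)
    case empty
    then show ?case by (simp add: L2_space_def)
  next
    case (insert i F)
    then show ?case using assms(1) by (auto intro!: L2_space_add(1) L2_space_scale)
  qed
  then show ?thesis using h by simp
qed

lemma combinationsI:
  "finite F \<Longrightarrow> F \<subseteq> I \<Longrightarrow> (\<lambda>x. \<Sum>i\<in>F. c i * \<phi> i x) \<in> combinations \<phi> I"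
  unfolding combinations_def by (rule CollectI, rule exI[of _ F], rule exI[of _ c]) simp

lemma combinations_add:
  assumes "h \<in> combinations \<phi> I" "k \<in> combinations \<phi> I"
  shows "(\<lambda>x. h x + k x) \<in> combinations \<phi> I"
proof -
  obtain F c where F: "finite F" "F \<subseteq> I" and h: "h = (\<lambda>x. \<Sum>i\<in>F. c i * \<phi> i x)"
    using assms(1) by (auto simp: combinations_def)
  obtain G e where G: "finite G" "G \<subseteq> I" and k: "k = (\<lambda>x. \<Sum>i\<in>G. e i * \<phi> i x)"
    using assms(2) by (auto simp: combinations_def)
  define s where "s i = (if i \<in> F then c i else 0) + (if i \<in> G then e i else 0)" for i
  have "h x + k x = (\<Sum>i\<in>F \<union> G. s i * \<phi> i x)" for x
  proof -
    have "h x = (\<Sum>i\<in>F \<union> G. (if i \<in> F then c i else 0) * \<phi> i x)"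
      unfolding h by (rule sum.mono_neutral_cong_left) (use F G in auto)
    moreover have "k x = (\<Sum>i\<in>F \<union> G. (if i \<in> G then e i else 0) * \<phi> i x)"
      unfolding k by (rule sum.mono_neutral_cong_left) (use F G in auto)
    ultimately show ?thesis
      by (simp add: s_def sum.distrib distrib_right)
  qed
  then have "(\<lambda>x. h x + k x) = (\<lambda>x. \<Sum>i\<in>F \<union> G. s i * \<phi> i x)"
    by (rule ext)
  then show ?thesis
    using F G by (auto intro: combinationsI)
qed

lemma combinations_scale:
  assumes "h \<in> combinations \<phi> I"
  shows "(\<lambda>x. a * h x) \<in> combinations \<phi> I"
proof -
  obtain F c where F: "finite F" "F \<subseteq> I" and h: "h = (\<lambda>x. \<Sum>i\<in>F. c i * \<phi> i x)"
    using assms by (auto simp: combinations_def)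
  have "(\<lambda>x. a * h x) = (\<lambda>x. \<Sum>i\<in>F. (a * c i) * \<phi> i x)"
    by (simp add: h sum_distrib_left mult.assoc)
  then show ?thesis using combinationsI[OF F] by simp
qed

lemma closed_span_L2: "f \<in> closed_span M \<phi> I \<Longrightarrow> f \<in> L2_space M"
  by (simp add: closed_span_def)

lemma combinations_subset_closed_span:
  assumes "\<And>i. i \<in> I \<Longrightarrow> \<phi> i \<in> L2_space M" and "h \<in> combinations \<phi> I"
  shows "h \<in> closed_span M \<phi> I"
  unfolding closed_span_def
  using combinations_subset_L2_space[OF assms]
  by (auto intro!: bexI[OF _ assms(2)] simp: sq_norm_def)

lemma closed_span_closed:
  assumes \<phi>: "\<And>i. i \<in> I \<Longrightarrow> \<phi> i \<in> L2_space M" and f: "f \<in> L2_space M"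
    and approx: "\<And>\<epsilon>. \<epsilon> > 0 \<Longrightarrow> \<exists>g\<in>closed_span M \<phi> I. sq_norm M (\<lambda>x. f x - g x) < \<epsilon>"
  shows "f \<in> closed_span M \<phi> I"
  unfolding closed_span_def
proof (intro CollectI conjI f allI impI)
  fix \<epsilon> :: real assume "\<epsilon> > 0"
  then obtain g where g: "g \<in> closed_span M \<phi> I" "sq_norm M (\<lambda>x. f x - g x) < \<epsilon> / 4"
    using approx[of "\<epsilon> / 4"] by auto
  obtain h where h: "h \<in> combinations \<phi> I" "sq_norm M (\<lambda>x. g x - h x) < \<epsilon> / 4"
    using g(1) \<open>\<epsilon> > 0\<close> by (auto simp: closed_span_def dest!: spec[of _ "\<epsilon> / 4"])
  have "sq_norm M (\<lambda>x. (f x - g x) + (g x - h x)) \<le>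
      2 * sq_norm M (\<lambda>x. f x - g x) + 2 * sq_norm M (\<lambda>x. g x - h x)"
    by (intro L2_space_add(2) L2_space_diff f closed_span_L2[OF g(1)]
        combinations_subset_L2_space[OF \<phi> h(1)])
  then have "sq_norm M (\<lambda>x. f x - h x) < \<epsilon>"
    using g(2) h(2) by simp
  then show "\<exists>h\<in>combinations \<phi> I. sq_norm M (\<lambda>x. f x - h x) < \<epsilon>"
    using h(1) by blast
qed

lemma closed_span_add:
  assumes \<phi>: "\<And>i. i \<in> I \<Longrightarrow> \<phi> i \<in> L2_space M"
    and f: "f \<in> closed_span M \<phi> I" and g: "g \<in> closed_span M \<phi> I"
  shows "(\<lambda>x. f x + g x) \<in> closed_span M \<phi> I"
  unfolding closed_span_def
proof (intro CollectI conjI allI impI L2_space_add(1) closed_span_L2[OF f] closed_span_L2[OF g])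
  fix \<epsilon> :: real assume "\<epsilon> > 0"
  obtain h where h: "h \<in> combinations \<phi> I" "sq_norm M (\<lambda>x. f x - h x) < \<epsilon> / 4"
    using f \<open>\<epsilon> > 0\<close> by (auto simp: closed_span_def dest!: spec[of _ "\<epsilon> / 4"])
  obtain k where k: "k \<in> combinations \<phi> I" "sq_norm M (\<lambda>x. g x - k x) < \<epsilon> / 4"
    using g \<open>\<epsilon> > 0\<close> by (auto simp: closed_span_def dest!: spec[of _ "\<epsilon> / 4"])
  have "sq_norm M (\<lambda>x. (f x - h x) + (g x - k x)) \<le>
      2 * sq_norm M (\<lambda>x. f x - h x) + 2 * sq_norm M (\<lambda>x. g x - k x)"
    by (intro L2_space_add(2) L2_space_diff closed_span_L2[OF f] closed_span_L2[OF g]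
        combinations_subset_L2_space[OF \<phi> h(1)] combinations_subset_L2_space[OF \<phi> k(1)])
  then have "sq_norm M (\<lambda>x. (f x + g x) - (h x + k x)) < \<epsilon>"
    using h(2) k(2) by (simp add: algebra_simps)
  then show "\<exists>h\<in>combinations \<phi> I. sq_norm M (\<lambda>x. (f x + g x) - h x) < \<epsilon>"
    by (rule bexI[OF _ combinations_add[OF h(1) k(1)]])
qed

lemma closed_span_scale:
  assumes \<phi>: "\<And>i. i \<in> I \<Longrightarrow> \<phi> i \<in> L2_space M" and f: "f \<in> closed_span M \<phi> I"
  shows "(\<lambda>x. a * f x) \<in> closed_span M \<phi> I"
  unfolding closed_span_def
proof (intro CollectI conjI allI impI L2_space_scale closed_span_L2[OF f])
  fix \<epsilon> :: real assume "\<epsilon> > 0"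
  define \<delta> where "\<delta> = \<epsilon> / ((cmod a)\<^sup>2 + 1)"
  have pos: "(cmod a)\<^sup>2 + 1 > 0" by (simp add: add_nonneg_pos)
  have "\<delta> > 0" using \<open>\<epsilon> > 0\<close> pos by (simp add: \<delta>_def)
  then obtain h where h: "h \<in> combinations \<phi> I" "sq_norm M (\<lambda>x. f x - h x) < \<delta>"
    using f by (auto simp: closed_span_def)
  have "sq_norm M (\<lambda>x. a * (f x - h x)) \<le> (cmod a)\<^sup>2 * sq_norm M (\<lambda>x. f x - h x)"
    by (intro L2_space_bounded_mult(2) L2_space_diff closed_span_L2[OF f]
        combinations_subset_L2_space[OF \<phi> h(1)]) auto
  also have "\<dots> \<le> (cmod a)\<^sup>2 * \<delta>"
    using h(2) by (intro mult_left_mono) auto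
  also have "\<dots> < ((cmod a)\<^sup>2 + 1) * \<delta>"
    using \<open>\<delta> > 0\<close> by (simp add: distrib_right)
  also have "\<dots> = \<epsilon>" using pos by (simp add: \<delta>_def)
  finally have "sq_norm M (\<lambda>x. a * f x - a * h x) < \<epsilon>"
    by (simp add: right_diff_distrib)
  then show "\<exists>h\<in>combinations \<phi> I. sq_norm M (\<lambda>x. a * f x - h x) < \<epsilon>"
    by (rule bexI[OF _ combinations_scale[OF h(1)]])
qed

lemma closed_span_sum:
  assumes \<phi>: "\<And>i. i \<in> I \<Longrightarrow> \<phi> i \<in> L2_space M" and "finite J"
    and "\<And>j. j \<in> J \<Longrightarrow> g j \<in> closed_span M \<phi> I"
  shows "(\<lambda>x. \<Sum>j\<in>J. g j x) \<in> closed_span M \<phi> I"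
  using assms(2,3)
proof (induction J rule: finite_induct)
  case empty
  have "(\<lambda>x. \<Sum>i\<in>{}. 0 * \<phi> i x) \<in> closed_span M \<phi> I"
    by (intro combinations_subset_closed_span combinationsI \<phi>) auto
  then show ?case by simp
next
  case (insert j J)
  then show ?case by (simp add: closed_span_add \<phi>)
qed

text \<open>Multiplication by a bounded function is continuous on \<open>L\<^sup>2\<close>, so it maps the closed span into
  itself as soon as it maps the generators there.\<close>

lemma closed_span_bounded_mult:
  assumes \<phi>: "\<And>i. i \<in> I \<Longrightarrow> \<phi> i \<in> L2_space M" and [measurable]: "g \<in> borel_measurable M"
    and bound: "AE x in M. cmod (g x) \<le> B"
    and mult: "\<And>i. i \<in> I \<Longrightarrow> (\<lambda>x. g x * \<phi> i x) \<in> closed_span M \<phi> I"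
    and f: "f \<in> closed_span M \<phi> I"
  shows "(\<lambda>x. g x * f x) \<in> closed_span M \<phi> I"
proof (rule closed_span_closed[OF \<phi>])
  show "(\<lambda>x. g x * f x) \<in> L2_space M"
    by (rule L2_space_bounded_mult(1)[OF closed_span_L2[OF f] _ bound]) simp
  fix \<epsilon> :: real assume "\<epsilon> > 0"
  define \<delta> where "\<delta> = \<epsilon> / (B\<^sup>2 + 1)"
  have pos: "B\<^sup>2 + 1 > 0" by (simp add: add_nonneg_pos)
  have "\<delta> > 0" using \<open>\<epsilon> > 0\<close> pos by (simp add: \<delta>_def)
  then obtain h where h: "h \<in> combinations \<phi> I" "sq_norm M (\<lambda>x. f x - h x) < \<delta>"
    using f by (auto simp: closed_span_def)
  obtain F c where F: "finite F" "F \<subseteq> I" and hF: "h = (\<lambda>x. \<Sum>i\<in>F. c i * \<phi> i x)"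
    using h(1) by (auto simp: combinations_def)
  have "(\<lambda>x. \<Sum>i\<in>F. c i * (g x * \<phi> i x)) \<in> closed_span M \<phi> I"
    by (intro closed_span_sum[OF \<phi> F(1)] closed_span_scale[OF \<phi>] mult) (use F in auto)
  then have gh: "(\<lambda>x. g x * h x) \<in> closed_span M \<phi> I"
    by (simp add: hF sum_distrib_left mult_ac)
  have "sq_norm M (\<lambda>x. g x * (f x - h x)) \<le> B\<^sup>2 * sq_norm M (\<lambda>x. f x - h x)"
    by (intro L2_space_bounded_mult(2) L2_space_diff closed_span_L2[OF f] bound
        combinations_subset_L2_space[OF \<phi> h(1)]) auto
  also have "\<dots> \<le> B\<^sup>2 * \<delta>"
    using h(2) by (intro mult_left_mono) auto
  also have "\<dots> < (B\<^sup>2 + 1) * \<delta>"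
    using \<open>\<delta> > 0\<close> by (simp add: distrib_right)
  also have "\<dots> = \<epsilon>" using pos by (simp add: \<delta>_def)
  finally have "sq_norm M (\<lambda>x. g x * f x - g x * h x) < \<epsilon>"
    by (simp add: right_diff_distrib)
  then show "\<exists>k\<in>closed_span M \<phi> I. sq_norm M (\<lambda>x. g x * f x - k x) < \<epsilon>"
    by (rule bexI[OF _ gh])
qed

text \<open>The dominating function is square integrable, so dominated convergence applies to
  \<open>|f - s\<^sub>n|\<^sup>2 \<le> 4 w\<^sup>2\<close>. Continuous functions, indicators and general elements of \<open>L\<^sup>2\<close> are all reached
  through limits of this kind.\<close>

lemma closed_span_dominated_limit:
  assumes \<phi>: "\<And>i. i \<in> I \<Longrightarrow> \<phi> i \<in> L2_space M"
    and s: "\<And>n. s n \<in> closed_span M \<phi> I"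
    and [measurable]: "f \<in> borel_measurable M"
    and lim: "AE x in M. (\<lambda>n. s n x) \<longlonglongrightarrow> f x"
    and dom: "\<And>n. AE x in M. cmod (s n x) \<le> w x"
    and [measurable]: "w \<in> borel_measurable M"
    and w: "integrable M (\<lambda>x. (w x)\<^sup>2)"
  shows "f \<in> closed_span M \<phi> I"
proof (rule closed_span_closed[OF \<phi>])
  have [measurable]: "s n \<in> borel_measurable M" for n
    using closed_span_L2[OF s] by (rule L2_spaceD)
  have dom': "AE x in M. \<forall>n. cmod (s n x) \<le> w x"
    using dom by (simp add: AE_all_countable)
  have fw: "AE x in M. cmod (f x) \<le> w x"
    using lim dom'
  proof eventually_elim
    case (elim x)
    then show ?case
      by (intro LIMSEQ_le_const2[OF tendsto_norm[OF elim(1)]]) auto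
  qed
  have fw2: "AE x in M. norm ((cmod (f x))\<^sup>2) \<le> norm ((w x)\<^sup>2)"
    using fw by eventually_elim (auto intro!: power_mono)
  show f: "f \<in> L2_space M"
    unfolding L2_space_def by (auto intro!: Bochner_Integration.integrable_bound[OF w _ fw2])
  have "(\<lambda>n. LINT x|M. (cmod (f x - s n x))\<^sup>2) \<longlonglongrightarrow> (LINT x|M. 0)"
  proof (rule integral_dominated_convergence[where w = "\<lambda>x. 4 * (w x)\<^sup>2"])
    show "AE x in M. (\<lambda>n. (cmod (f x - s n x))\<^sup>2) \<longlonglongrightarrow> 0"
      using lim
    proof eventually_elim
      case (elim x)
      have "(\<lambda>n. (cmod (f x - s n x))\<^sup>2) \<longlonglongrightarrow> (cmod (f x - f x))\<^sup>2"
        by (intro tendsto_intros elim)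
      then show ?case by simp
    qed
    show "AE x in M. norm ((cmod (f x - s n x))\<^sup>2) \<le> 4 * (w x)\<^sup>2" for n
      using fw dom[of n]
    proof eventually_elim
      case (elim x)
      have "(cmod (f x - s n x))\<^sup>2 \<le> (2 * w x)\<^sup>2"
        using norm_triangle_ineq4[of "f x" "s n x"] elim by (intro power_mono) auto
      then show ?case by (simp add: power_mult_distrib)
    qed
  qed (use w in auto)
  then have lim0: "(\<lambda>n. sq_norm M (\<lambda>x. f x - s n x)) \<longlonglongrightarrow> 0"
    by (simp add: sq_norm_def)
  fix \<epsilon> :: real assume "\<epsilon> > 0"
  then have "eventually (\<lambda>n. sq_norm M (\<lambda>x. f x - s n x) < \<epsilon>) sequentially"
    using lim0 order_tendstoD(2) by blast
  then show "\<exists>g\<in>closed_span M \<phi> I. sq_norm M (\<lambda>x. f x - g x) < \<epsilon>"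
    using s by (auto simp: eventually_sequentially)
qed

section \<open>Totality of the exponentials\<close>

context real_distribution
begin

lemma bounded_in_L2_space:
  assumes [measurable]: "f \<in> borel_measurable borel" and "\<And>x. cmod (f x) \<le> B"
  shows "f \<in> L2_space M"
proof -
  have "integrable M (\<lambda>x. (cmod (f x))\<^sup>2)"
    by (rule integrable_const_bound[where B = "B\<^sup>2"]) (auto intro!: AE_I2 power_mono assms(2))
  then show ?thesis by (simp add: L2_space_def)
qed

lemma expo_in_L2_space: "expo l \<in> L2_space M"
  by (rule bounded_in_L2_space[where B = 1]) auto

context
  fixes K L :: "real set"
  assumes K: "compact K" "AE x in M. x \<in> K"
    and all: "\<And>t. expo t \<in> closed_span M expo L"
begin

lemma one_in_closed_span: "(\<lambda>_. 1) \<in> closed_span M expo L"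
proof -
  have "expo 0 = (\<lambda>_. 1)" by (simp add: fun_eq_iff)
  then show ?thesis using all[of 0] by simp
qed

lemma expo_mult_closed_span:
  assumes "p \<in> closed_span M expo L"
  shows "(\<lambda>x. expo a x * p x) \<in> closed_span M expo L"
  by (rule closed_span_bounded_mult[where B = 1])
     (use all in \<open>auto intro!: expo_in_L2_space assms simp flip: expo_add\<close>)

text \<open>Stone-Weierstrass asks for an algebra of real functions. The closed span itself is not visibly closed
  under products, but the functions that multiply it into itself are.\<close>

definition multiplier :: "(real \<Rightarrow> real) \<Rightarrow> bool" where
  "multiplier g \<longleftrightarrow> continuous_on UNIV g \<and>
     (\<forall>p\<in>closed_span M expo L. (\<lambda>x. of_real (g x) * p x) \<in> closed_span M expo L)"

text \<open>The shift \<open>y\<close> is what lets cosines separate points: with a suitable frequency the value is \<open>1\<close> at \<open>y\<close>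
  and \<open>-1\<close> at a given other point.\<close>

lemma multiplier_cos: "multiplier (\<lambda>x. cos (2 * pi * a * (x - y)))"
  unfolding multiplier_def
proof (intro conjI ballI continuous_intros)
  fix p assume p: "p \<in> closed_span M expo L"
  have "of_real (cos (2 * pi * a * (x - y))) * p x =
      (expo a (- y) / 2) * (expo a x * p x) + (expo (- a) (- y) / 2) * (expo (- a) x * p x)" for x
  proof -
    have "complex_of_real (cos (2 * pi * a * (x - y))) = (expo a (x - y) + expo (- a) (x - y)) / 2"
      by (auto simp: expo_cis complex_eq_iff)
    also have "\<dots> = (expo a (- y) / 2) * expo a x + (expo (- a) (- y) / 2) * expo (- a) x"
      using expo_add_right[of a "- y" x] expo_add_right[of "- a" "- y" x]
      by (simp add: add_divide_distrib)
    finally show ?thesis by (simp add: algebra_simps)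
  qed
  then show "(\<lambda>x. of_real (cos (2 * pi * a * (x - y))) * p x) \<in> closed_span M expo L"
    by (simp only:)
       (intro closed_span_add closed_span_scale expo_mult_closed_span p expo_in_L2_space)
qed

lemma continuous_in_closed_span:
  fixes f :: "real \<Rightarrow> real"
  assumes f: "continuous_on UNIV f" and B: "\<And>x. \<bar>f x\<bar> \<le> B"
  shows "(\<lambda>x. of_real (f x)) \<in> closed_span M expo L"
proof -
  have "\<exists>g. multiplier g \<and> (\<forall>x\<in>K. \<bar>f x - g x\<bar> < e)" if "e > 0" for e
  proof (rule Stone_Weierstrass_HOL[OF K(1)])
    show "multiplier (\<lambda>x. c)" for c
      unfolding multiplier_def by (auto intro!: closed_span_scale expo_in_L2_space)
    show "continuous_on K g" if "multiplier g" for g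
      using that continuous_on_subset unfolding multiplier_def by blast
    show "multiplier (\<lambda>x. g x + h x)" if "multiplier g \<and> multiplier h" for g h
      using that unfolding multiplier_def
      by (auto intro!: continuous_intros closed_span_add expo_in_L2_space simp: distrib_right)
    show "multiplier (\<lambda>x. g x * h x)" if "multiplier g \<and> multiplier h" for g h
      using that unfolding multiplier_def
      by (auto intro!: continuous_intros simp: mult.assoc)
    show "\<exists>g. multiplier g \<and> g x \<noteq> g y" if "x \<in> K \<and> y \<in> K \<and> x \<noteq> y" for x y
    proof -
      define a where "a = (1 / 2) / (x - y)"
      have "a * (x - y) = 1 / 2"
        using that by (simp add: a_def)
      then have "2 * pi * a * (x - y) = 2 * pi * (1 / 2)"
        by (simp only: mult.assoc)
      also have "2 * pi * (1 / 2) = pi"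
        by simp
      finally have "2 * pi * a * (x - y) = pi" .
      then have "cos (2 * pi * a * (x - y)) \<noteq> cos (2 * pi * a * (y - y))"
        by (simp only: cos_pi) simp
      then show ?thesis
        by (intro exI[of _ "\<lambda>t. cos (2 * pi * a * (t - y))"] conjI multiplier_cos)
    qed
    show "continuous_on K f" using f continuous_on_subset by blast
  qed (use that in auto)
  then have "\<forall>n. \<exists>g. multiplier g \<and> (\<forall>x\<in>K. \<bar>f x - g x\<bar> < inverse (real (Suc n)))"
    by simp
  then obtain g where g: "\<And>n. multiplier (g n)"
    and approx: "\<And>n x. x \<in> K \<Longrightarrow> \<bar>f x - g n x\<bar> < inverse (real (Suc n))"
    by metis
  show ?thesis
  proof (rule closed_span_dominated_limit[where s = "\<lambda>n x. of_real (g n x)" and w = "\<lambda>_. B + 1"])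
    show "(\<lambda>x. complex_of_real (g n x)) \<in> closed_span M expo L" for n
      using g[of n] one_in_closed_span unfolding multiplier_def by fastforce
    show "(\<lambda>x. complex_of_real (f x)) \<in> borel_measurable M"
      using borel_measurable_continuous_onI[OF f] by simp
    show "AE x in M. (\<lambda>n. complex_of_real (g n x)) \<longlonglongrightarrow> complex_of_real (f x)"
      using K(2)
    proof eventually_elim
      case (elim x)
      have "(\<lambda>n. f x - g n x) \<longlonglongrightarrow> 0"
        by (rule LIMSEQ_norm_0) (use approx[OF elim] in \<open>simp add: inverse_eq_divide\<close>)
      then have "(\<lambda>n. f x - (f x - g n x)) \<longlonglongrightarrow> f x - 0"
        by (intro tendsto_intros)
      then show ?case by (auto intro: tendsto_of_real)
    qed
    show "AE x in M. cmod (complex_of_real (g n x)) \<le> B + 1" for n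
      using K(2)
    proof eventually_elim
      case (elim x)
      have "inverse (real (Suc n)) \<le> 1" by (simp add: field_simps)
      then show ?case using approx[OF elim, of n] B[of x] by simp
    qed
  qed (auto intro: expo_in_L2_space)
qed

text \<open>The continuous approximations are \<open>1\<close> up to \<open>a\<close> and fall linearly to \<open>0\<close> with slope \<open>-n\<close>.\<close>

lemma indicator_atMost_in_closed_span:
  fixes a :: real
  shows "(\<lambda>x. of_real (indicator {..a} x)) \<in> closed_span M expo L"
proof (rule closed_span_dominated_limit[where w = "\<lambda>_. 1"
      and s = "\<lambda>n x. of_real (max 0 (min 1 (1 - real n * (x - a))))"])
  show "(\<lambda>x. complex_of_real (max 0 (min 1 (1 - real n * (x - a))))) \<in> closed_span M expo L" for n
    by (rule continuous_in_closed_span[where B = 1]) (auto intro!: continuous_intros)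
  show "AE x in M. (\<lambda>n. complex_of_real (max 0 (min 1 (1 - real n * (x - a)))))
      \<longlonglongrightarrow> complex_of_real (indicator {..a} x)"
  proof (intro AE_I2 tendsto_of_real tendsto_eventually)
    fix x
    show "\<forall>\<^sub>F n in sequentially. max 0 (min 1 (1 - real n * (x - a))) = indicator {..a} x"
    proof (cases "x \<le> a")
      case True
      then have "1 \<le> 1 - real n * (x - a)" for n
        by (simp add: mult_nonneg_nonpos)
      then have "max 0 (min 1 (1 - real n * (x - a))) = 1" for n
        by (simp add: min_absorb1)
      then show ?thesis using True by simp
    next
      case False
      obtain N :: nat where N: "1 / (x - a) < real N" using reals_Archimedean2 by blast
      show ?thesis
      proof (rule eventually_sequentiallyI[of N])
        fix n assume "N \<le> n"
        then have "1 / (x - a) < real n" using N by linarith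
        then have "1 < real n * (x - a)" using False by (simp add: field_simps)
        then show "max 0 (min 1 (1 - real n * (x - a))) = indicator {..a} x"
          using False by (simp add: max_def)
      qed
    qed
  qed
qed (auto intro: expo_in_L2_space)

text \<open>The sets with this property form a Dynkin system, and the half-lines generate the Borel sets and are
  stable under intersection.\<close>

lemma indicator_in_closed_span:
  fixes A :: "real set"
  assumes A: "A \<in> sets borel"
  shows "(\<lambda>x. of_real (indicator A x)) \<in> closed_span M expo L"
proof -
  let ?G = "range (\<lambda>a::real. {..a})"
  have sets: "sets borel = sigma_sets UNIV ?G"
    unfolding borel_eq_atMost by (rule sets_measure_of) simp
  have "Int_stable ?G"
    by (auto simp: Int_stable_def)
  moreover have "?G \<subseteq> Pow UNIV" by simp
  moreover have "A \<in> sigma_sets UNIV ?G" using A sets by simp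
  ultimately show ?thesis
  proof (induction A rule: sigma_sets_induct_disjoint)
    case (basic A)
    then show ?case using indicator_atMost_in_closed_span by auto
  next
    case empty
    show ?case using closed_span_scale[OF _ one_in_closed_span, of 0] expo_in_L2_space by simp
  next
    case (compl A)
    have "(\<lambda>x. 1 + (- 1) * of_real (indicator A x)) \<in> closed_span M expo L"
      by (intro closed_span_add closed_span_scale one_in_closed_span compl expo_in_L2_space)
    moreover have "(\<lambda>x. 1 + (- 1) * complex_of_real (indicator A x)) =
        (\<lambda>x. of_real (indicator (UNIV - A) x))"
      by (auto simp: fun_eq_iff indicator_def)
    ultimately show ?case by simp
  next
    case (union A)
    have [measurable]: "A i \<in> sets borel" for i using union(2) sets by blast
    show ?case
    proof (rule closed_span_dominated_limit[where w = "\<lambda>_. 1"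
          and s = "\<lambda>n x. \<Sum>i<n. of_real (indicator (A i) x)"])
      have eq: "(\<Sum>i<n. indicator (A i) x) = (indicator (\<Union>i<n. A i) x :: real)" for n x
        using union(1) by (subst indicator_UN_disjoint)
          (auto simp: disjoint_family_on_def)
      show "(\<lambda>x. \<Sum>i<n. complex_of_real (indicator (A i) x)) \<in> closed_span M expo L" for n
        by (intro closed_span_sum union(3) expo_in_L2_space) auto
      show "AE x in M. (\<lambda>n. \<Sum>i<n. complex_of_real (indicator (A i) x))
          \<longlonglongrightarrow> complex_of_real (indicator (\<Union> (range A)) x)"
        by (simp only: of_real_sum[symmetric] eq)
           (intro AE_I2 tendsto_of_real LIMSEQ_indicator_UN)
      show "AE x in M. cmod (\<Sum>i<n. complex_of_real (indicator (A i) x)) \<le> 1" for n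
        by (simp only: of_real_sum[symmetric] eq norm_of_real) (simp add: indicator_def)
    qed (auto intro: expo_in_L2_space)
  qed
qed

text \<open>A square integrable \<open>f\<close> is a limit of simple functions bounded by \<open>2|f|\<close>, and these are finite
  combinations of indicators.\<close>

lemma L2_space_subset_closed_span:
  assumes f: "f \<in> L2_space M"
  shows "f \<in> closed_span M expo L"
proof -
  note [measurable] = L2_spaceD[OF f]
  obtain s where s: "\<And>i. simple_function M (s i)"
    and lim: "\<And>x. (\<lambda>i. s i x) \<longlonglongrightarrow> f x"
    and dom: "\<And>i x. cmod (s i x) \<le> 2 * cmod (f x)"
    using borel_measurable_implies_sequence_metric[OF L2_spaceD[OF f], of 0] by auto
  have "s i \<in> closed_span M expo L" for i
  proof -
    have fin: "finite (range (s i))"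
      using simple_functionD(1)[OF s[of i]] by simp
    have "(\<lambda>x. \<Sum>y\<in>range (s i). y * of_real (indicator (s i -` {y}) x)) \<in> closed_span M expo L"
    proof (intro closed_span_sum closed_span_scale indicator_in_closed_span fin expo_in_L2_space)
      show "s i -` {y} \<in> sets borel" for y
        using simple_functionD(2)[OF s[of i], of "{y}"] by simp
    qed
    moreover have "(\<Sum>y\<in>range (s i). y * of_real (indicator (s i -` {y}) x)) = s i x" for x
      using fin by (subst sum.remove[of _ "s i x"]) (auto simp: indicator_def intro!: sum.neutral)
    ultimately show ?thesis by simp
  qed
  then show ?thesis
    by (rule closed_span_dominated_limit[where s = s and w = "\<lambda>x. 2 * cmod (f x)", rotated])
       (use lim dom L2_space_integrable[OF f] in \<open>auto simp: power_mult_distrib intro: expo_in_L2_space\<close>)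
qed

end

end

section \<open>Random series with independent uniform digits\<close>

text \<open>Reduction modulo \<open>m\<close> is the identity on the digits that occur. It makes the random variable bounded on
  the whole sample space, so that the random series below converges everywhere and not only almost
  surely.\<close>

lemma integral_expo_uniform_digit:
  assumes "m > 0"
  shows "(LINT j|measure_pmf (pmf_of_set {..<m}). expo t (s * real (j mod m))) = H m (s * t)"
proof -
  have "(LINT j|measure_pmf (pmf_of_set {..<m}). expo t (s * real (j mod m))) =
      (\<Sum>j<m. expo t (s * real (j mod m)) * of_real (pmf (pmf_of_set {..<m}) j))"
    using assms by (subst integral_measure_pmf[where A = "{..<m}"])
      (auto simp: set_pmf_of_set lessThan_empty_iff scaleR_conv_of_real mult.commute)
  also have "\<dots> = (\<Sum>j<m. expo (real j) (s * t) / of_nat m)"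
    using assms by (intro sum.cong refl) (simp add: pmf_of_set lessThan_empty_iff expo_cis mult_ac)
  also have "\<dots> = H m (s * t)"
    by (simp add: H_def sum_divide_distrib)
  finally show ?thesis .
qed

text \<open>The measure is the law of \<open>\<Sum>n. s\<^sub>n \<epsilon>\<^sub>n\<close> with independent \<open>\<epsilon>\<^sub>n\<close>, uniform on \<open>{0, \<dots>, d\<^sub>n - 1}\<close>. By
  independence the partial sums have the partial products as Fourier transforms. The summability
  hypothesis bounds the series, which gives the compact support.\<close>

lemma ex_measure_fourier_transform_eq_lim_prod_H:
  fixes d :: "nat \<Rightarrow> nat" and s :: "nat \<Rightarrow> real"
  assumes d: "\<And>n. d n > 0" and summ: "summable (\<lambda>n. real (d n) * \<bar>s n\<bar>)"
  shows "\<exists>\<mu>. compactly_supported_prob \<mu> \<and>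
     (\<forall>t. (\<lambda>N. \<Prod>k<N. H (d k) (s k * t)) \<longlonglongrightarrow> fourier_transform \<mu> t)"
proof -
  define p where "p n = measure_pmf (pmf_of_set {..<d n})" for n
  have "prob_space (p n)" for n
    unfolding p_def by (rule prob_space_measure_pmf)
  then interpret product_prob_space p UNIV
    by (rule product_prob_spaceI)
  let ?P = "PiM UNIV p"
  define X where "X n \<omega> = s n * real (\<omega> n mod d n)" for n and \<omega> :: "nat \<Rightarrow> nat"
  define S where "S \<omega> = (\<Sum>n. X n \<omega>)" for \<omega>
  define B where "B = (\<Sum>n. real (d n) * \<bar>s n\<bar>)"
  have X_meas [measurable]: "X n \<in> borel_measurable ?P" for n
  proof -
    have "(\<lambda>j. s n * real (j mod d n)) \<in> borel_measurable (p n)" by (simp add: p_def)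
    then show ?thesis unfolding X_def
      by (rule measurable_compose[rotated]) simp
  qed
  have X_le: "\<bar>X n \<omega>\<bar> \<le> real (d n) * \<bar>s n\<bar>" for n \<omega>
  proof -
    have "real (\<omega> n mod d n) \<le> real (d n)" using d[of n] by (simp add: less_imp_le)
    then have "real (\<omega> n mod d n) * \<bar>s n\<bar> \<le> real (d n) * \<bar>s n\<bar>"
      by (rule mult_right_mono) simp
    then show ?thesis by (simp add: X_def abs_mult mult.commute)
  qed
  have X_summable: "summable (\<lambda>n. \<bar>X n \<omega>\<bar>)" for \<omega>
    by (rule summable_comparison_test'[OF summ]) (use X_le in auto)
  have S_lim: "(\<lambda>N. \<Sum>n<N. X n \<omega>) \<longlonglongrightarrow> S \<omega>" for \<omega>
    unfolding S_def by (rule summable_LIMSEQ[OF summable_rabs_cancel[OF X_summable]])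
  have [measurable]: "S \<in> borel_measurable ?P"
    unfolding S_def by measurable
  have S_le: "\<bar>S \<omega>\<bar> \<le> B" for \<omega>
  proof -
    have "\<bar>S \<omega>\<bar> \<le> (\<Sum>n. \<bar>X n \<omega>\<bar>)" unfolding S_def by (rule summable_rabs[OF X_summable])
    also have "\<dots> \<le> B" unfolding B_def by (intro suminf_le X_le X_summable summ)
    finally show ?thesis .
  qed
  define \<mu> where "\<mu> = distr ?P borel S"
  have "real_distribution \<mu>"
    unfolding \<mu>_def by (rule real_distribution_distr) simp
  moreover have "S \<omega> \<in> {-B..B}" for \<omega>
    using S_le[of \<omega>] by (simp add: abs_le_iff)
  then have "AE x in \<mu>. x \<in> {-B..B}"
    unfolding \<mu>_def by (subst AE_distr_iff) simp_all
  ultimately have cs: "compactly_supported_prob \<mu>"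
    unfolding compactly_supported_prob_def by blast
  have "(\<lambda>N. \<Prod>k<N. H (d k) (s k * t)) \<longlonglongrightarrow> fourier_transform \<mu> t" for t
  proof -
    have fin: "(LINT \<omega>|?P. expo t (\<Sum>n<N. X n \<omega>)) = (\<Prod>k<N. H (d k) (s k * t))" for N
    proof -
      let ?J = "{..<N}"
      define g where "g k j = expo t (s k * real (j mod d k))" for k j
      have g_meas: "g k \<in> borel_measurable (p k)" for k
        by (simp add: p_def)
      have "(\<lambda>x. g k (x k)) \<in> borel_measurable (PiM ?J p)" if "k \<in> ?J" for k
        by (rule measurable_compose[OF measurable_component_singleton[OF that] g_meas])
      then have prod_meas: "(\<lambda>x. \<Prod>k<N. g k (x k)) \<in> borel_measurable (PiM ?J p)"
        by (rule borel_measurable_prod)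
      have expo_sum: "expo t (\<Sum>n<N. X n \<omega>) = (\<Prod>k<N. g k (\<omega> k))" for \<omega>
        by (induction N) (simp_all add: expo_add_right X_def g_def)
      have "(LINT \<omega>|?P. expo t (\<Sum>n<N. X n \<omega>)) = (LINT \<omega>|?P. (\<Prod>k<N. g k (restrict \<omega> ?J k)))"
        unfolding expo_sum by (intro Bochner_Integration.integral_cong refl prod.cong) auto
      also have "\<dots> = (LINT x|distr ?P (PiM ?J p) (\<lambda>\<omega>. restrict \<omega> ?J). (\<Prod>k<N. g k (x k)))"
        by (rule integral_distr[OF measurable_restrict_subset[OF subset_UNIV] prod_meas, symmetric])
      also have "\<dots> = (LINT x|PiM ?J p. (\<Prod>k<N. g k (x k)))"
        by (subst distr_PiM_restrict_finite) auto
      also have "\<dots> = (\<Prod>k<N. LINT j|p k. g k j)"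
        by (intro product_integral_prod)
          (auto simp: p_def g_def intro!: measure_pmf.integrable_const_bound[where B = 1])
      also have "\<dots> = (\<Prod>k<N. H (d k) (s k * t))"
        unfolding p_def g_def by (intro prod.cong refl integral_expo_uniform_digit d)
      finally show ?thesis .
    qed
    have "(\<lambda>N. LINT \<omega>|?P. expo t (\<Sum>n<N. X n \<omega>)) \<longlonglongrightarrow> (LINT \<omega>|?P. expo t (S \<omega>))"
    proof (rule integral_dominated_convergence[where w = "\<lambda>_. 1"])
      show "AE \<omega> in ?P. (\<lambda>N. expo t (\<Sum>n<N. X n \<omega>)) \<longlonglongrightarrow> expo t (S \<omega>)"
        using continuous_on_tendsto_compose[OF continuous_expo[of UNIV t] S_lim] by auto
    qed auto
    moreover have "(LINT \<omega>|?P. expo t (S \<omega>)) = fourier_transform \<mu> t"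
      unfolding fourier_transform_def \<mu>_def by (simp add: integral_distr)
    ultimately show ?thesis by (simp add: fin)
  qed
  then show ?thesis using cs by blast
qed

text \<open>Up to rescaling of the argument this is Levy's uniqueness theorem for characteristic functions.\<close>

lemma fourier_transform_inject:
  assumes "compactly_supported_prob \<mu>" "compactly_supported_prob \<nu>"
    and eq: "\<And>t. fourier_transform \<mu> t = fourier_transform \<nu> t"
  shows "\<mu> = \<nu>"
proof (rule Levy_uniqueness)
  have char: "char M t = fourier_transform M (- t / (2 * pi))" for M :: "real measure" and t
    unfolding char_def fourier_transform_def expo_def
    by (intro Bochner_Integration.integral_cong refl arg_cong[where f = exp]) simp
  show "char \<mu> = char \<nu>"
    by (simp add: fun_eq_iff char eq)
qed (use assms in \<open>auto simp: compactly_supported_prob_def\<close>)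

section \<open>Periodicity and Parseval identity of the partial products\<close>

locale riesz_sequences =
  fixes b d :: "nat \<Rightarrow> nat"
  assumes d_gt_1: "\<And>n. n \<ge> 1 \<Longrightarrow> 1 < d n"
    and d_dvd_b: "\<And>n. n \<ge> 1 \<Longrightarrow> d n dvd b n"
    and two_le_quotient: "\<And>n. n \<ge> 1 \<Longrightarrow> 2 \<le> b n div d n"
begin

lemma rho_1 [simp]: "rho b (Suc 0) = 1"
  by (simp add: rho_def)

lemma rho_Suc: "rho b (Suc (Suc n)) = rho b (Suc n) * b (Suc n)"
  by (simp add: rho_def atLeastLessThanSuc mult.commute)

lemma d_pos [simp]: "0 < d (Suc n)"
  using d_gt_1[of "Suc n"] by simp

lemma two_d_le_b: "2 * d (Suc n) \<le> b (Suc n)"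
proof -
  have "2 * d (Suc n) \<le> (b (Suc n) div d (Suc n)) * d (Suc n)"
    using two_le_quotient[of "Suc n"] by (intro mult_right_mono) auto
  then show ?thesis using d_dvd_b[of "Suc n"] by simp
qed

lemma four_le_b: "4 \<le> b (Suc n)"
  using two_d_le_b[of n] d_gt_1[of "Suc n"] by simp

lemma rho_ge_power_mult: "4 ^ j * rho b (Suc n) \<le> rho b (Suc (n + j))"
proof (induction j)
  case (Suc j)
  have "4 ^ Suc j * rho b (Suc n) \<le> b (Suc (n + j)) * rho b (Suc (n + j))"
    using mult_mono[OF four_le_b[of "n + j"] Suc] by (simp add: mult.assoc)
  then show ?case by (simp add: rho_Suc mult.commute)
qed simp

lemma rho_ge_power: "4 ^ n \<le> rho b (Suc n)"
  using rho_ge_power_mult[of n 0] by simp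

lemma rho_pos [simp]: "0 < rho b (Suc n)"
  using rho_ge_power[of n] by (meson less_le_trans zero_less_power zero_less_numeral)

lemma d_rho_dvd_rho: "k < n \<Longrightarrow> d (Suc k) * rho b (Suc k) dvd rho b (Suc n)"
proof (induction n)
  case (Suc n)
  show ?case
  proof (cases "k = n")
    case True
    then show ?thesis
      using mult_dvd_mono[OF d_dvd_b[of "Suc n"] dvd_refl[of "rho b (Suc n)"]]
      by (simp add: rho_Suc mult.commute)
  next
    case False
    then have "d (Suc k) * rho b (Suc k) dvd rho b (Suc n)" using Suc by simp
    then show ?thesis by (simp add: rho_Suc)
  qed
qed simp

text \<open>The indices of the sequences are shifted by one, so that factors are numbered from \<open>0\<close>, as in an
  infinite product.\<close>

definition riesz_factor :: "nat \<Rightarrow> real \<Rightarrow> complex" where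
  "riesz_factor k t = H (d (Suc k)) (t / (real (d (Suc k)) * real (rho b (Suc k))))"

definition riesz_prod :: "nat \<Rightarrow> real \<Rightarrow> complex" where
  "riesz_prod n t = (\<Prod>k<n. riesz_factor k t)"

lemma norm_riesz_factor_le_1: "cmod (riesz_factor k t) \<le> 1"
  by (simp add: riesz_factor_def norm_H_le_1)

lemma riesz_factor_conv: 
  "riesz_factor k t = H (d (Suc k)) ((t / real (rho b (Suc k))) / real (d (Suc k)))"
  by (simp add: riesz_factor_def mult.commute)

lemma norm_riesz_factor_minus_1_le:
  "cmod (riesz_factor k t - 1) \<le> pi * (\<bar>t\<bar> / real (rho b (Suc k)))"
  unfolding riesz_factor_conv
  using norm_H_minus_1_le[of "d (Suc k)" "t / real (rho b (Suc k))"] by simp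

text \<open>Each earlier scale \<open>d\<^sub>k\<rho>\<^sub>k\<close> divides \<open>\<rho>\<^sub>n\<^sub>+\<^sub>1\<close>, because \<open>d\<^sub>k\<close> divides \<open>b\<^sub>k\<close>; and \<open>H\<close> has period \<open>1\<close>.\<close>

lemma riesz_prod_periodic:
  assumes "m \<in> \<int>"
  shows "riesz_prod n (t + m * real (rho b (Suc n))) = riesz_prod n t"
  unfolding riesz_prod_def
proof (rule prod.cong[OF refl])
  fix k assume "k \<in> {..<n}"
  then obtain q where q: "rho b (Suc n) = (d (Suc k) * rho b (Suc k)) * q"
    using d_rho_dvd_rho by (meson dvdE lessThan_iff)
  have "(t + m * real (rho b (Suc n))) / (real (d (Suc k)) * real (rho b (Suc k))) =
      t / (real (d (Suc k)) * real (rho b (Suc k))) + m * real q"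
    unfolding q using d_pos[of k] rho_pos[of k] by (simp add: add_divide_distrib del: d_pos rho_pos)
  then show "riesz_factor k (t + m * real (rho b (Suc n))) = riesz_factor k t"
    unfolding riesz_factor_def using assms by (simp add: H_add_Ints)
qed

text \<open>The spectrum is the union of these sets. The recursion over the leading digit fits the induction in the
  Parseval identity; the empty digit string contributes \<open>0\<close>.\<close>

primrec digit_sums :: "nat \<Rightarrow> nat set" where
  "digit_sums 0 = {0}"
| "digit_sums (Suc n) = (\<lambda>(l, c). l + c * rho b (Suc n)) ` (digit_sums n \<times> {..<d (Suc n)})"

lemma finite_digit_sums [simp]: "finite (digit_sums n)"
  by (induction n) auto

text \<open>The factor \<open>2\<close> comes from \<open>2 d\<^sub>n \<le> b\<^sub>n\<close>. It keeps the digit sums in the first half of a period, which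
  is what the lower bound on the remaining factors relies on.\<close>

lemma digit_sums_less: "l \<in> digit_sums n \<Longrightarrow> 2 * l < rho b (Suc n)"
proof (induction n arbitrary: l)
  case (Suc n)
  then obtain l' c where l: "l = l' + c * rho b (Suc n)" "l' \<in> digit_sums n" "c < d (Suc n)"
    by auto
  have "2 * l < rho b (Suc n) + 2 * c * rho b (Suc n)"
    using Suc.IH[OF l(2)] l(1) by simp
  also have "\<dots> \<le> (2 * d (Suc n)) * rho b (Suc n)"
  proof -
    have "(1 + 2 * c) * rho b (Suc n) \<le> (2 * d (Suc n)) * rho b (Suc n)"
      using l(3) by (intro mult_right_mono) auto
    then show ?thesis by (simp add: algebra_simps)
  qed
  also have "\<dots> \<le> rho b (Suc (Suc n))"
    using mult_right_mono[OF two_d_le_b[of n], of "rho b (Suc n)"] by (simp add: rho_Suc mult.commute)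
  finally show ?case .
qed simp

text \<open>The pair is recovered by division with remainder, as \<open>l < \<rho>\<^sub>n\<^sub>+\<^sub>1\<close>.\<close>

lemma inj_on_digit_sum:
  "inj_on (\<lambda>(l, c). l + c * rho b (Suc n)) (digit_sums n \<times> {..<d (Suc n)})"
proof (rule inj_onI, clarsimp)
  fix l c l' c'
  assume l: "l \<in> digit_sums n" "l' \<in> digit_sums n"
    and eq: "l + c * rho b (Suc n) = l' + c' * rho b (Suc n)"
  have less: "l < rho b (Suc n)" "l' < rho b (Suc n)"
    using digit_sums_less[OF l(1)] digit_sums_less[OF l(2)] by auto
  have "l = l'"
    using arg_cong[OF eq, of "\<lambda>x. x mod rho b (Suc n)"] less by simp
  moreover have "c = c'"
    using eq \<open>l = l'\<close> rho_pos[of n] by simp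
  ultimately show "l = l' \<and> c = c'" ..
qed

lemma incseq_digit_sums: "incseq digit_sums"
proof (rule incseq_SucI)
  fix n
  show "digit_sums n \<le> digit_sums (Suc n)"
  proof
    fix l assume "l \<in> digit_sums n"
    then show "l \<in> digit_sums (Suc n)"
      by (auto intro!: image_eqI[where x = "(l, 0)"])
  qed
qed

lemma digit_sums_eq:
  "digit_sums L = {\<Sum>n=1..L. c n * rho b n | c. \<forall>n\<in>{1..L}. c n \<in> {0..d n - 1}}"
proof (induction L)
  case (Suc L)
  show ?case
  proof (intro set_eqI iffI)
    fix l assume "l \<in> digit_sums (Suc L)"
    then obtain l' e where l: "l = l' + e * rho b (Suc L)" "l' \<in> digit_sums L" "e < d (Suc L)"
      by auto
    then obtain c where c: "l' = (\<Sum>n=1..L. c n * rho b n)" "\<forall>n\<in>{1..L}. c n \<in> {0..d n - 1}"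
      using Suc by auto
    have "l = (\<Sum>n=1..Suc L. (c(Suc L := e)) n * rho b n)"
      using l(1) c(1) by simp
    moreover have "\<forall>n\<in>{1..Suc L}. (c(Suc L := e)) n \<in> {0..d n - 1}"
      using c(2) l(3) by (auto simp: le_Suc_eq)
    ultimately show "l \<in> {\<Sum>n=1..Suc L. c n * rho b n | c. \<forall>n\<in>{1..Suc L}. c n \<in> {0..d n - 1}}"
      by blast
  next
    fix l assume "l \<in> {\<Sum>n=1..Suc L. c n * rho b n | c. \<forall>n\<in>{1..Suc L}. c n \<in> {0..d n - 1}}"
    then obtain c where c: "l = (\<Sum>n=1..Suc L. c n * rho b n)" "\<forall>n\<in>{1..Suc L}. c n \<in> {0..d n - 1}"
      by blast
    have "(\<Sum>n=1..L. c n * rho b n) \<in> digit_sums L"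
      unfolding Suc using c(2) by fastforce
    moreover have "c (Suc L) < d (Suc L)"
      using bspec[OF c(2), of "Suc L"] d_pos[of L] by (auto simp del: d_pos)
    ultimately show "l \<in> digit_sums (Suc L)"
      using c(1) by (auto intro!: image_eqI[where x = "(\<Sum>n=1..L. c n * rho b n, c (Suc L))"])
  qed
qed simp

lemma Lambda_set_eq: "Lambda_set b d = (\<Union>n. real ` digit_sums n)"
proof -
  have "Lambda_set b d = (\<Union>L\<in>{1..}. real ` digit_sums L)"
    unfolding Lambda_set_def digit_sums_eq by (intro SUP_cong refl) blast
  also have "\<dots> = (\<Union>n. real ` digit_sums n)"
  proof (intro equalityI subsetI)
    fix x assume "x \<in> (\<Union>n. real ` digit_sums n)"
    then obtain n where "x \<in> real ` digit_sums n" by blast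
    then have "x \<in> real ` digit_sums (Suc n)"
      using incseqD[OF incseq_digit_sums, of n "Suc n"] by auto
    then show "x \<in> (\<Union>L\<in>{1..}. real ` digit_sums L)" by (intro UN_I[of "Suc n"]) auto
  qed auto
  finally show ?thesis .
qed

text \<open>Subtracting a multiple of \<open>\<rho>\<^sub>n\<^sub>+\<^sub>1\<close> does not affect the first \<open>n\<close> factors and moves the argument of the new factor by
  \<open>c / d\<^sub>n\<^sub>+\<^sub>1\<close>, so the sum over the new digit is a full Parseval sum for \<open>H\<close>.\<close>

lemma riesz_prod_parseval:
  "(\<Sum>l\<in>digit_sums n. (cmod (riesz_prod n (t - real l)))\<^sup>2) = 1"
proof (induction n)
  case 0
  then show ?case by (simp add: riesz_prod_def)
next
  case (Suc n)
  let ?\<rho> = "rho b (Suc n)" and ?d = "d (Suc n)"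
  have level: "riesz_prod (Suc n) (t - real (l + c * ?\<rho>)) =
      riesz_prod n (t - real l) * H ?d ((t - real l) / (real ?d * real ?\<rho>) - real c / real ?d)" for l c
  proof -
    have "riesz_prod n (t - real (l + c * ?\<rho>)) = riesz_prod n (t - real l)"
      using riesz_prod_periodic[of "- real c" n "t - real l"] by (simp add: algebra_simps)
    moreover have "(t - real (l + c * ?\<rho>)) / (real ?d * real ?\<rho>) =
        (t - real l) / (real ?d * real ?\<rho>) - real c / real ?d"
      using rho_pos[of n] by (simp add: diff_divide_distrib add_divide_distrib del: rho_pos)
    ultimately show ?thesis
      by (simp add: riesz_prod_def riesz_factor_def)
  qed
  have "(\<Sum>l\<in>digit_sums (Suc n). (cmod (riesz_prod (Suc n) (t - real l)))\<^sup>2) =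
      (\<Sum>(l, c)\<in>digit_sums n \<times> {..<?d}. (cmod (riesz_prod (Suc n) (t - real (l + c * ?\<rho>))))\<^sup>2)"
    unfolding digit_sums.simps by (subst sum.reindex[OF inj_on_digit_sum]) (simp add: case_prod_beta)
  also have "\<dots> = (\<Sum>l\<in>digit_sums n. \<Sum>c<?d. (cmod (riesz_prod (Suc n) (t - real (l + c * ?\<rho>))))\<^sup>2)"
    by (rule sum.cartesian_product[symmetric])
  also have "\<dots> = (\<Sum>l\<in>digit_sums n. (cmod (riesz_prod n (t - real l)))\<^sup>2 *
      (\<Sum>c<?d. (cmod (H ?d ((t - real l) / (real ?d * real ?\<rho>) - real c / real ?d)))\<^sup>2))"
    unfolding level by (simp only: norm_mult power_mult_distrib sum_distrib_left)
  also have "\<dots> = 1"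
    by (simp only: H_parseval[OF d_pos] mult_1_right Suc)
  finally show ?case .
qed

lemma riesz_prod_0 [simp]: "riesz_prod n 0 = 1"
  by (simp add: riesz_prod_def riesz_factor_def H_0)

text \<open>In the Parseval identity at \<open>t = l\<close> the term of \<open>l\<close> itself equals \<open>1\<close> and leaves nothing for the others.\<close>

lemma riesz_prod_diff_eq_0:
  assumes "l \<in> digit_sums n" "l' \<in> digit_sums n" "l \<noteq> l'"
  shows "riesz_prod n (real l - real l') = 0"
proof -
  let ?q = "\<lambda>k. (cmod (riesz_prod n (real l - real k)))\<^sup>2"
  have "(\<Sum>k\<in>digit_sums n. ?q k) = ?q l + (\<Sum>k\<in>digit_sums n - {l}. ?q k)"
    using assms by (intro sum.remove) auto
  then have "(\<Sum>k\<in>digit_sums n - {l}. ?q k) = 0"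
    by (simp add: riesz_prod_parseval)
  then have "?q l' = 0"
    using assms by (subst (asm) sum_nonneg_eq_0_iff) auto
  then show ?thesis by simp
qed

section \<open>The Riesz product measure\<close>

lemma inverse_rho_le: "1 / real (rho b (Suc n)) \<le> (1 / 4) ^ n"
proof -
  have "(4::real) ^ n \<le> real (rho b (Suc n))"
    using rho_ge_power[of n] by (metis of_nat_le_iff of_nat_numeral of_nat_power)
  then have "1 / real (rho b (Suc n)) \<le> 1 / 4 ^ n"
    by (intro divide_left_mono) auto
  then show ?thesis by (simp add: power_one_over)
qed

lemma summable_inverse_rho: "summable (\<lambda>n. 1 / real (rho b (Suc n)))"
  by (rule summable_comparison_test'[OF summable_geometric[of "1 / 4 :: real"]])
     (use inverse_rho_le in auto)

text \<open>The factors may vanish, so a product that converges in the strict sense needs a nonzero tail; this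
  follows from absolute convergence, as \<open>\<rho>\<close> grows at least like powers of \<open>4\<close>.\<close>

lemma convergent_prod_riesz_factor: "convergent_prod (\<lambda>k. riesz_factor k t)"
proof (rule abs_convergent_prod_imp_convergent_prod, rule summable_imp_abs_convergent_prod)
  show "summable (\<lambda>k. norm (riesz_factor k t - 1))"
  proof (rule summable_comparison_test')
    show "summable (\<lambda>k. (pi * \<bar>t\<bar>) * (1 / real (rho b (Suc k))))"
      by (intro summable_mult summable_inverse_rho)
    show "norm (norm (riesz_factor k t - 1)) \<le> (pi * \<bar>t\<bar>) * (1 / real (rho b (Suc k)))" for k
      using norm_riesz_factor_minus_1_le[of k t] by simp
  qed
qed

text \<open>Existence comes from the random series, whose Fourier transform is the limit of the partial products
  and hence the value of the convergent product. Uniqueness justifies the definite description.\<close>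

lemma riesz_product_measure_properties:
  shows compactly_supported_riesz: "compactly_supported_prob (riesz_product_measure b d)"
    and has_prod_riesz: "(\<lambda>k. riesz_factor k t) has_prod fourier_transform (riesz_product_measure b d) t"
proof -
  let ?Q = "\<lambda>\<mu>. compactly_supported_prob \<mu> \<and>
     (\<forall>\<xi>. (\<lambda>n. riesz_factor n \<xi>) has_prod fourier_transform \<mu> \<xi>)"
  define s where "s n = 1 / (real (d (Suc n)) * real (rho b (Suc n)))" for n
  have "summable (\<lambda>n. real (d (Suc n)) * \<bar>s n\<bar>)"
    using summable_inverse_rho by (simp add: s_def less_imp_neq[OF d_pos, symmetric])
  then obtain \<mu> where \<mu>: "compactly_supported_prob \<mu>"
    and lim: "\<And>t. (\<lambda>N. \<Prod>k<N. H (d (Suc k)) (s k * t)) \<longlonglongrightarrow> fourier_transform \<mu> t"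
    using ex_measure_fourier_transform_eq_lim_prod_H[of "\<lambda>n. d (Suc n)" s] d_pos by auto
  have "(\<lambda>n. riesz_factor n t) has_prod fourier_transform \<mu> t" for t
  proof -
    have hp: "(\<lambda>n. riesz_factor n t) has_prod prodinf (\<lambda>n. riesz_factor n t)"
      by (rule convergent_prod_has_prod[OF convergent_prod_riesz_factor])
    have "(\<lambda>N. \<Prod>k<N. riesz_factor k t) \<longlonglongrightarrow> fourier_transform \<mu> t"
      using lim[of t] by (simp add: riesz_factor_def s_def)
    then show ?thesis
      using has_prod_imp_tendsto'[OF hp] LIMSEQ_unique hp by metis
  qed
  then have "?Q \<mu>" using \<mu> by blast
  moreover have "\<nu> = \<mu>" if "?Q \<nu>" for \<nu>
  proof (rule fourier_transform_inject)
    show "fourier_transform \<nu> t = fourier_transform \<mu> t" for t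
      using that \<open>?Q \<mu>\<close> by (intro has_prod_unique2[of "\<lambda>n. riesz_factor n t"]) auto
  qed (use that \<open>?Q \<mu>\<close> in auto)
  ultimately have "?Q (THE \<mu>. ?Q \<mu>)" by (rule theI[of ?Q \<mu>])
  moreover have "riesz_product_measure b d = (THE \<mu>. ?Q \<mu>)"
    unfolding riesz_product_measure_def riesz_factor_def ..
  ultimately show "compactly_supported_prob (riesz_product_measure b d)"
    and "(\<lambda>k. riesz_factor k t) has_prod fourier_transform (riesz_product_measure b d) t" by auto
qed

end

section \<open>Orthonormality and completeness\<close>

lemma fourier_transform_minus: "fourier_transform M (- t) = cnj (fourier_transform M t)"
  unfolding fourier_transform_def cnj_expo[symmetric] by simp

lemma (in real_distribution) integrable_expo: "integrable M (expo t)"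
  by (rule integrable_const_bound[where B = 1]) auto

text \<open>This is Bessel's equality: the numbers \<open>m(t - l)\<close> are the inner products of \<open>e\<^sub>t\<close> with the
  orthonormal \<open>e\<^sub>l\<close>, where \<open>m\<close> is the Fourier transform of the measure.\<close>

lemma (in real_distribution) sq_norm_expo_residual:
  fixes F :: "real set"
  assumes F: "finite F"
    and orth: "\<And>l l'. l \<in> F \<Longrightarrow> l' \<in> F \<Longrightarrow> l \<noteq> l' \<Longrightarrow> fourier_transform M (l - l') = 0"
  shows "sq_norm M (\<lambda>x. expo t x - (\<Sum>l\<in>F. fourier_transform M (t - l) * expo l x)) =
    1 - (\<Sum>l\<in>F. (cmod (fourier_transform M (t - l)))\<^sup>2)"
proof -
  define m where "m = fourier_transform M"
  have m_int: "(LINT x|M. expo u x) = m u" for u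
    by (simp add: m_def fourier_transform_def)
  have m0: "m 0 = 1"
    using prob_space by (simp add: m_def fourier_transform_def)
  have m_minus: "m (- u) = cnj (m u)" for u
    by (simp add: m_def fourier_transform_minus)
  let ?D = "\<lambda>x. expo t x - (\<Sum>l\<in>F. m (t - l) * expo l x)"
  have expand: "complex_of_real ((cmod (?D x))\<^sup>2) =
      1 - (\<Sum>l\<in>F. cnj (m (t - l)) * expo (t - l) x) - (\<Sum>l\<in>F. m (t - l) * expo (l - t) x) +
      (\<Sum>l\<in>F. \<Sum>l'\<in>F. m (t - l) * cnj (m (t - l')) * expo (l - l') x)" for x
  proof -
    define S where "S = (\<Sum>l\<in>F. m (t - l) * expo l x)"
    have "expo t x * cnj (expo t x) = 1" by (simp flip: expo_diff)
    then have "(expo t x - S) * cnj (expo t x - S) =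
        1 - expo t x * cnj S - S * cnj (expo t x) + S * cnj S"
      by (simp add: algebra_simps)
    also have "expo t x * cnj S = (\<Sum>l\<in>F. cnj (m (t - l)) * expo (t - l) x)"
      by (simp add: S_def expo_diff sum_distrib_left mult_ac)
    also have "S * cnj (expo t x) = (\<Sum>l\<in>F. m (t - l) * expo (l - t) x)"
      by (simp add: S_def expo_diff sum_distrib_left mult_ac)
    also have "S * cnj S = (\<Sum>l\<in>F. \<Sum>l'\<in>F. m (t - l) * cnj (m (t - l')) * expo (l - l') x)"
      by (simp add: S_def expo_diff sum_product mult_ac)
    finally show ?thesis
      by (simp only: complex_norm_square S_def)
  qed
  have "complex_of_real (sq_norm M ?D) = (LINT x|M. complex_of_real ((cmod (?D x))\<^sup>2))"
    unfolding sq_norm_def by (rule integral_complex_of_real[symmetric])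
  also have "\<dots> = 1 - (\<Sum>l\<in>F. cnj (m (t - l)) * m (t - l)) - (\<Sum>l\<in>F. m (t - l) * m (l - t)) +
      (\<Sum>l\<in>F. \<Sum>l'\<in>F. m (t - l) * cnj (m (t - l')) * m (l - l'))"
    using prob_space unfolding expand by (simp add: integrable_expo m_int)
  also have "(\<Sum>l\<in>F. \<Sum>l'\<in>F. m (t - l) * cnj (m (t - l')) * m (l - l')) =
      (\<Sum>l\<in>F. m (t - l) * cnj (m (t - l)))"
  proof (rule sum.cong[OF refl])
    fix l assume l: "l \<in> F"
    have "(\<Sum>l'\<in>F. m (t - l) * cnj (m (t - l')) * m (l - l')) =
        (\<Sum>l'\<in>F. if l = l' then m (t - l) * cnj (m (t - l)) else 0)"
      using l orth by (intro sum.cong refl) (auto simp: m0 m_def[symmetric])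
    then show "(\<Sum>l'\<in>F. m (t - l) * cnj (m (t - l')) * m (l - l')) = m (t - l) * cnj (m (t - l))"
      using l F by simp
  qed
  also have "1 - (\<Sum>l\<in>F. cnj (m (t - l)) * m (t - l)) - (\<Sum>l\<in>F. m (t - l) * m (l - t)) +
      (\<Sum>l\<in>F. m (t - l) * cnj (m (t - l))) = complex_of_real (1 - (\<Sum>l\<in>F. (cmod (m (t - l)))\<^sup>2))"
  proof -
    have "m (l - t) = cnj (m (t - l))" for l using m_minus[of "t - l"] by simp
    moreover have "m u * cnj (m u) = of_real ((cmod (m u))\<^sup>2)" "cnj (m u) * m u = of_real ((cmod (m u))\<^sup>2)" for u
      by (simp_all only: complex_norm_square mult.commute)
    ultimately show ?thesis by simp
  qed
  finally show ?thesis
    unfolding m_def of_real_eq_iff .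
qed

context riesz_sequences
begin

abbreviation riesz_fourier :: "real \<Rightarrow> complex" where
  "riesz_fourier \<equiv> fourier_transform (riesz_product_measure b d)"

lemma riesz_prod_tendsto: "(\<lambda>n. riesz_prod n t) \<longlonglongrightarrow> riesz_fourier t"
  unfolding riesz_prod_def by (rule has_prod_imp_tendsto'[OF has_prod_riesz])

lemma riesz_prod_add: "riesz_prod (n + m) t = riesz_prod n t * (\<Prod>j<m. riesz_factor (n + j) t)"
  by (induction m) (simp_all add: riesz_prod_def)

lemma norm_riesz_fourier_le: "cmod (riesz_fourier t) \<le> cmod (riesz_prod n t)"
proof (rule LIMSEQ_le_const2)
  show "(\<lambda>m. cmod (riesz_prod (m + n) t)) \<longlonglongrightarrow> cmod (riesz_fourier t)"
    by (intro tendsto_norm LIMSEQ_ignore_initial_segment riesz_prod_tendsto)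
  have "cmod (riesz_prod (m + n) t) \<le> cmod (riesz_prod n t)" for m
  proof -
    have "(\<Prod>j<m. cmod (riesz_factor (n + j) t)) \<le> 1"
      by (intro prod_le_1) (simp add: norm_riesz_factor_le_1)
    then show ?thesis
      by (simp add: add.commute[of m] riesz_prod_add norm_mult prod_norm[symmetric] mult_right_le_one_le prod_nonneg)
  qed
  then show "\<exists>N. \<forall>m\<ge>N. cmod (riesz_prod (m + n) t) \<le> cmod (riesz_prod n t)" by blast
qed

text \<open>For \<open>t\<close> in this range the factor with index \<open>n\<close> is at least the constant of \<open>H_bounded_below\<close>. After
  it, the ratio \<open>|t| / \<rho>\<close> decreases at least by the factor \<open>4\<close> in each step, so the distances of the
  factors from \<open>1\<close> sum to at most \<open>\<pi> \<cdot> 3/4 \<cdot> 1/3 = \<pi>/4 < 1\<close>, and the Weierstrass product inequality bounds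
  their product below by \<open>1 - \<pi>/4\<close>.\<close>

lemma riesz_fourier_bounded_below:
  "\<exists>c>0. \<forall>n t. \<bar>t\<bar> \<le> 3 / 4 * real (rho b (Suc n)) \<longrightarrow> c * cmod (riesz_prod n t) \<le> cmod (riesz_fourier t)"
proof -
  obtain c0 where c0: "c0 > 0" "\<And>m x. m > 0 \<Longrightarrow> \<bar>x\<bar> \<le> 3 / 4 \<Longrightarrow> c0 \<le> cmod (H m (x / real m))"
    using H_bounded_below by blast
  define c where "c = c0 * (1 - pi / 4)"
  have "c > 0" using c0(1) pi_less_4 by (simp add: c_def)
  moreover have "c * cmod (riesz_prod n t) \<le> cmod (riesz_fourier t)"
    if t: "\<bar>t\<bar> \<le> 3 / 4 * real (rho b (Suc n))" for n t
  proof (rule LIMSEQ_le_const)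
    show "(\<lambda>m. cmod (riesz_prod (m + Suc n) t)) \<longlonglongrightarrow> cmod (riesz_fourier t)"
      by (intro tendsto_norm LIMSEQ_ignore_initial_segment riesz_prod_tendsto)
    have "c * cmod (riesz_prod n t) \<le> cmod (riesz_prod (m + Suc n) t)" for m
    proof -
      have first: "c0 \<le> cmod (riesz_factor n t)"
        unfolding riesz_factor_conv using t by (intro c0(2)) (auto simp: field_simps)
      define a where "a j = 3 * pi / 4 * (1 / 4) ^ Suc j" for j :: nat
      have a_sum: "(\<Sum>j<m. a j) = pi / 4 * (1 - (1 / 4) ^ m)"
        by (induction m) (simp_all add: a_def field_simps)
      have a_range: "a j \<in> {0..1}" for j
      proof -
        have "a j \<le> 3 * pi / 4 * (1 / 4)"
          unfolding a_def using power_decreasing[of 1 "Suc j" "1 / 4 :: real"]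
          by (intro mult_left_mono) auto
        moreover have "0 \<le> a j" by (simp add: a_def)
        ultimately show ?thesis using pi_less_4 by simp
      qed
      have later: "1 - a j \<le> cmod (riesz_factor (Suc n + j) t)" for j
      proof -
        let ?R = "real (rho b (Suc (Suc n + j)))"
        have "real (4 ^ Suc j * rho b (Suc n)) \<le> ?R"
          using rho_ge_power_mult[of "Suc j" n] by (simp only: of_nat_le_iff add_Suc_right add_Suc)
        then have "4 ^ Suc j * real (rho b (Suc n)) \<le> ?R" by simp
        then have "3 / 4 * real (rho b (Suc n)) \<le> 3 / 4 * (1 / 4) ^ Suc j * ?R"
          by (simp add: power_one_over field_simps)
        then have "\<bar>t\<bar> / ?R \<le> 3 / 4 * (1 / 4) ^ Suc j"
          using t by (simp add: divide_le_eq del: power_Suc)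
        then have "pi * (\<bar>t\<bar> / ?R) \<le> pi * (3 / 4 * (1 / 4) ^ Suc j)"
          by (rule mult_left_mono) simp
        then have "pi * (\<bar>t\<bar> / ?R) \<le> a j"
          by (simp add: a_def)
        moreover have "1 - cmod (riesz_factor (Suc n + j) t) \<le> cmod (riesz_factor (Suc n + j) t - 1)"
          by (metis norm_minus_commute norm_one norm_triangle_ineq2)
        ultimately show ?thesis
          using norm_riesz_factor_minus_1_le[of "Suc n + j" t] by linarith
      qed
      have "1 - pi / 4 \<le> 1 - (\<Sum>j<m. a j)"
        unfolding a_sum by (simp add: mult_left_le)
      also have "\<dots> \<le> (\<Prod>j<m. 1 - a j)"
        by (rule Weierstrass_prod_ineq) (rule a_range)
      also have "\<dots> \<le> (\<Prod>j<m. cmod (riesz_factor (Suc n + j) t))"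
        using a_range later by (intro prod_mono) auto
      finally have "c0 * (1 - pi / 4) \<le>
          cmod (riesz_factor n t) * (\<Prod>j<m. cmod (riesz_factor (Suc n + j) t))"
        using first c0(1) pi_less_4 by (intro mult_mono) auto
      then have "cmod (riesz_prod n t) * c \<le> cmod (riesz_prod n t) *
          (cmod (riesz_factor n t) * (\<Prod>j<m. cmod (riesz_factor (Suc n + j) t)))"
        unfolding c_def by (intro mult_left_mono) auto
      also have "\<dots> = cmod (riesz_prod (m + Suc n) t)"
        unfolding add.commute[of m] riesz_prod_add[of "Suc n"]
        by (simp add: norm_mult prod_norm riesz_prod_def)
      finally show ?thesis by (simp add: mult.commute)
    qed
    then show "\<exists>N. \<forall>m\<ge>N. c * cmod (riesz_prod n t) \<le> cmod (riesz_prod (m + Suc n) t)" by blast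
  qed
  ultimately show ?thesis by blast
qed

lemma riesz_fourier_diff_eq_0:
  assumes "l \<in> digit_sums n" "l' \<in> digit_sums n" "l \<noteq> l'"
  shows "riesz_fourier (real l - real l') = 0"
  using norm_riesz_fourier_le[of "real l - real l'" n] by (simp add: riesz_prod_diff_eq_0[OF assms])

text \<open>The terms at level \<open>n\<close> tend to those of the limit, and for large \<open>n\<close> they are dominated on \<open>digit_sums n\<close> by
  \<open>|m(t - l)|\<^sup>2 / c\<^sup>2\<close>, where \<open>m\<close> is the Fourier transform of the measure. Splitting the identity for
  \<open>P\<^sub>n\<close> at a fixed level \<open>N\<close> and letting first \<open>n\<close> and then \<open>N\<close> tend to infinity excludes a loss of mass.\<close>

lemma riesz_fourier_parseval:
  "(\<lambda>n. \<Sum>l\<in>digit_sums n. (cmod (riesz_fourier (t - real l)))\<^sup>2) \<longlonglongrightarrow> 1"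
proof -
  define q where "q l = (cmod (riesz_fourier (t - real l)))\<^sup>2" for l
  define p where "p n l = (cmod (riesz_prod n (t - real l)))\<^sup>2" for n l
  define A where "A n = (\<Sum>l\<in>digit_sums n. q l)" for n
  have q_nonneg: "q l \<ge> 0" for l by (simp add: q_def)
  have q_le_p: "q l \<le> p n l" for n l
    unfolding p_def q_def by (intro power_mono norm_riesz_fourier_le) simp
  have p_sum: "(\<Sum>l\<in>digit_sums n. p n l) = 1" for n
    unfolding p_def by (rule riesz_prod_parseval)
  have A_le: "A n \<le> 1" for n
    unfolding A_def p_sum[of n, symmetric] by (intro sum_mono q_le_p)
  have "incseq A"
    unfolding incseq_def A_def
    by (intro allI impI sum_mono2 q_nonneg incseqD[OF incseq_digit_sums] finite_digit_sums)
  then obtain s where s: "A \<longlonglongrightarrow> s"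
    using incseq_convergent A_le by blast
  have "s \<le> 1" using LIMSEQ_le_const2[OF s] A_le by blast
  obtain c where c: "c > 0"
    and low: "\<And>n u. \<bar>u\<bar> \<le> 3 / 4 * real (rho b (Suc n)) \<Longrightarrow> c * cmod (riesz_prod n u) \<le> cmod (riesz_fourier u)"
    using riesz_fourier_bounded_below by blast
  \<comment> \<open>From level \<open>n0\<close> on, \<open>|t|\<close> is at most a quarter of the period, and one half plus one quarter is the
    admissible three quarters.\<close>
  obtain n0 :: nat where n0: "4 * \<bar>t\<bar> < 4 ^ n0"
    using real_arch_pow[of 4 "4 * \<bar>t\<bar>"] by auto
  have p_le: "p n l \<le> q l / c\<^sup>2" if "n \<ge> n0" "l \<in> digit_sums n" for n l
  proof -
    have "(4::real) ^ n0 \<le> 4 ^ n" using that(1) by (intro power_increasing) auto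
    also have "\<dots> \<le> real (rho b (Suc n))"
      using rho_ge_power[of n] by (metis of_nat_le_iff of_nat_numeral of_nat_power)
    finally have "4 * \<bar>t\<bar> \<le> real (rho b (Suc n))" using n0 by linarith
    moreover have "2 * real l \<le> real (rho b (Suc n))"
      using digit_sums_less[OF that(2)] by linarith
    ultimately have "\<bar>t - real l\<bar> \<le> 3 / 4 * real (rho b (Suc n))"
      using abs_triangle_ineq4[of t "real l"] by simp
    then have "(c * cmod (riesz_prod n (t - real l)))\<^sup>2 \<le> q l"
      unfolding q_def using c by (intro power_mono low) auto
    then show ?thesis
      using c by (simp add: p_def power_mult_distrib field_simps)
  qed
  have bound: "1 \<le> (\<Sum>l\<in>digit_sums N. p n l) + (A n - A N) / c\<^sup>2" if "n \<ge> N" "n \<ge> n0" for N n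
  proof -
    have sub: "digit_sums N \<subseteq> digit_sums n" by (rule incseqD[OF incseq_digit_sums that(1)])
    have "1 = (\<Sum>l\<in>digit_sums n - digit_sums N. p n l) + (\<Sum>l\<in>digit_sums N. p n l)"
      unfolding p_sum[of n, symmetric] by (rule sum.subset_diff[OF sub]) simp
    also have "(\<Sum>l\<in>digit_sums n - digit_sums N. p n l) \<le> (\<Sum>l\<in>digit_sums n - digit_sums N. q l / c\<^sup>2)"
      by (intro sum_mono p_le that(2)) auto
    also have "\<dots> = (A n - A N) / c\<^sup>2"
      unfolding A_def sum_divide_distrib[symmetric] by (subst sum_diff[OF _ sub]) auto
    finally show ?thesis by simp
  qed
  have "1 \<le> A N + (s - A N) / c\<^sup>2" for N
  proof (rule LIMSEQ_le_const)
    show "(\<lambda>n. (\<Sum>l\<in>digit_sums N. p n l) + (A n - A N) / c\<^sup>2) \<longlonglongrightarrow> A N + (s - A N) / c\<^sup>2"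
      unfolding p_def A_def[of N] q_def
      by (intro tendsto_intros riesz_prod_tendsto s) (use c in auto)
    show "\<exists>M. \<forall>n\<ge>M. 1 \<le> (\<Sum>l\<in>digit_sums N. p n l) + (A n - A N) / c\<^sup>2"
      by (rule exI[of _ "max N n0"]) (simp add: bound)
  qed
  moreover have "(\<lambda>N. A N + (s - A N) / c\<^sup>2) \<longlonglongrightarrow> s + (s - s) / c\<^sup>2"
    by (intro tendsto_intros s) (use c in auto)
  ultimately have "1 \<le> s + (s - s) / c\<^sup>2"
    by (intro LIMSEQ_le_const) auto
  then have "s = 1" using \<open>s \<le> 1\<close> by simp
  then show ?thesis using s unfolding A_def q_def by simp
qed

lemma real_distribution_riesz: "real_distribution (riesz_product_measure b d)"
  using compactly_supported_riesz by (simp add: compactly_supported_prob_def)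

text \<open>By Bessel's equality the squared distance from \<open>e\<^sub>t\<close> to the span of the first digit sums is the defect in
  the Parseval identity, which tends to \<open>0\<close>.\<close>

lemma expo_in_closed_span_Lambda:
  "expo t \<in> closed_span (riesz_product_measure b d) expo (Lambda_set b d)"
proof -
  let ?M = "riesz_product_measure b d"
  interpret real_distribution ?M by (rule real_distribution_riesz)
  show ?thesis
    unfolding closed_span_def
  proof (intro CollectI conjI allI impI expo_in_L2_space)
    fix \<epsilon> :: real assume "\<epsilon> > 0"
    then have "\<forall>\<^sub>F n in sequentially.
        1 - \<epsilon> < (\<Sum>l\<in>digit_sums n. (cmod (riesz_fourier (t - real l)))\<^sup>2)"
      by (intro order_tendstoD(1)[OF riesz_fourier_parseval]) auto
    then obtain n where n: "1 - \<epsilon> < (\<Sum>l\<in>digit_sums n. (cmod (riesz_fourier (t - real l)))\<^sup>2)"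
      by (auto simp: eventually_sequentially)
    let ?F = "real ` digit_sums n"
    let ?h = "\<lambda>x. \<Sum>l\<in>?F. riesz_fourier (t - l) * expo l x"
    have "sq_norm ?M (\<lambda>x. expo t x - ?h x) = 1 - (\<Sum>l\<in>?F. (cmod (riesz_fourier (t - l)))\<^sup>2)"
      by (rule sq_norm_expo_residual) (auto simp: riesz_fourier_diff_eq_0)
    also have "(\<Sum>l\<in>?F. (cmod (riesz_fourier (t - l)))\<^sup>2) =
        (\<Sum>l\<in>digit_sums n. (cmod (riesz_fourier (t - real l)))\<^sup>2)"
      by (subst sum.reindex) auto
    finally have "sq_norm ?M (\<lambda>x. expo t x - ?h x) < \<epsilon>" using n by simp
    moreover have "?h \<in> combinations expo (Lambda_set b d)"
      by (intro combinationsI) (auto simp: Lambda_set_eq)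
    ultimately show "\<exists>h\<in>combinations expo (Lambda_set b d). sq_norm ?M (\<lambda>x. expo t x - h x) < \<epsilon>"
      by (rule bexI)
  qed
qed

lemma L2_inner_expo_Lambda:
  assumes "u \<in> Lambda_set b d" "v \<in> Lambda_set b d"
  shows "L2_inner (riesz_product_measure b d) (expo u) (expo v) = (if u = v then 1 else 0)"
proof -
  interpret real_distribution "riesz_product_measure b d" by (rule real_distribution_riesz)
  have inner: "L2_inner (riesz_product_measure b d) (expo u) (expo v) = riesz_fourier (u - v)"
    by (simp add: L2_inner_def fourier_transform_def expo_diff)
  obtain n l m k where l: "u = real l" "l \<in> digit_sums n" and k: "v = real k" "k \<in> digit_sums m"
    using assms by (auto simp: Lambda_set_eq)
  have "l \<in> digit_sums (max n m)" "k \<in> digit_sums (max n m)"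
    using l(2) k(2) incseqD[OF incseq_digit_sums, of n "max n m"]
      incseqD[OF incseq_digit_sums, of m "max n m"] by auto
  then show ?thesis
    using inner riesz_fourier_diff_eq_0[of l "max n m" k] prob_space
    by (auto simp: l k fourier_transform_def)
qed

lemma is_spectrum_riesz: "is_spectrum (riesz_product_measure b d) (Lambda_set b d)"
proof -
  let ?M = "riesz_product_measure b d" and ?L = "Lambda_set b d"
  interpret real_distribution ?M by (rule real_distribution_riesz)
  obtain K where K: "compact K" "AE x in ?M. x \<in> K"
    using compactly_supported_riesz by (auto simp: compactly_supported_prob_def)
  have dense: "\<exists>F c. finite F \<and> F \<subseteq> ?L \<and> L2_nrm ?M (\<lambda>x. f x - (\<Sum>i\<in>F. c i * expo i x)) < \<epsilon>"
    if f: "f \<in> L2_space ?M" and \<epsilon>: "\<epsilon> > 0" for f \<epsilon>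
  proof -
    have "f \<in> closed_span ?M expo ?L"
      by (rule L2_space_subset_closed_span[OF K expo_in_closed_span_Lambda f])
    then obtain h where h: "h \<in> combinations expo ?L" "sq_norm ?M (\<lambda>x. f x - h x) < \<epsilon>\<^sup>2"
      using \<epsilon> unfolding closed_span_def by (auto dest!: spec[of _ "\<epsilon>\<^sup>2"])
    obtain F c where F: "finite F" "F \<subseteq> ?L" "h = (\<lambda>x. \<Sum>i\<in>F. c i * expo i x)"
      using h(1) by (auto simp: combinations_def)
    have "sqrt (sq_norm ?M (\<lambda>x. f x - h x)) < \<epsilon>"
      using h(2) \<epsilon> real_sqrt_less_mono by fastforce
    then show ?thesis
      using F by (auto simp: L2_nrm_def sq_norm_def)
  qed
  have "countable ?L"
    by (auto simp: Lambda_set_eq intro!: countable_UN countable_finite)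
  then show ?thesis
    unfolding is_spectrum_def L2_orthonormal_basis_def
    using compactly_supported_riesz expo_in_L2_space L2_inner_expo_Lambda dense by blast
qed

end

theorem theorem1p1:
  fixes b d :: "nat \<Rightarrow> nat"
  assumes "\<And>n. n \<ge> 1 \<Longrightarrow> 1 < d n \<and> d n < b n"
    and "\<And>n. n \<ge> 1 \<Longrightarrow> d n dvd b n \<and> 2 \<le> b n div d n"
  shows "is_spectrum (riesz_product_measure b d) (Lambda_set b d)"
proof -
  interpret riesz_sequences b d
    by unfold_locales (use assms in auto)
  show ?thesis by (rule is_spectrum_riesz)
qed

end
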